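(* Let $f$ be a transcendental entire function such that there exists $\rho>0$ with $m^n(\rho)\to\infty$ as $n\to\infty$ (so that the set $V(f)$ is well defined). (a) We have $V(f)=A(f)$ if and only if there exist $r\ge R>0$ such that $$m^n(r)\ge M^n(R)\ \text{ for } n\in\mathbb{N},\quad\text{and}\quad M^n(R)\to\infty\ \text{ as } n\to\infty.$$ (b) If the equivalent conditions in part (a) hold, then (i) $V(f)$ and $I(f)$ are spiders' webs, and (ii) $F(f)$ has no unbounded components.
   Context: For the entire function $f$: $M(r)=\max_{|z|=r}|f(z)|$, $m(r)=\min_{|z|=r}|f(z)|$, $\widetilde m(r)=\max_{0\le s\le r}m(s)$; $M^n,m^n,\widetilde m^{\,n},f^n$ denote $n$th iterates; $\mathbb{N}=\{1,2,\dots\}$, $\mathbb{N}_0=\mathbb{N}\cup\{0\}$. The Fatou set $F(f)$ is the set of $z\in\mathbb{C}$ such that $\{f^n:n\in\mathbb{N}\}$ is normal in some neighbourhood of $z$. The escaping set is $I(f)=\{z\in\mathbb{C}:f^n(z)\to\infty\text{ as }n\to\infty\}$. The fast escaping set is $A(f)=\bigcup_{\ell\in\mathbb{N}_0}f^{-\ell}(A_R(f))$, where $A_R(f)=\{z:|f^n(z)|\ge M^n(R),\text{ for }n\in\mathbb{N}\}$ and $R>0$ is such that $M^n(R)\to\infty$ as $n\to\infty$; $A(f)$ is independent of the choice of such $R$. If there exists $\rho>0$ with $m^n(\rho)\to\infty$, then there is $R>0$ such that $\widetilde m(r)>r$ for $r\ge R$, and $V(f)=\bigcup_{\ell\in\mathbb{N}_0}f^{-\ell}(V_R(f))$,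 where $V_R(f)=\{z:|f^n(z)|\ge\widetilde m^{\,n}(R),\text{ for }n\in\mathbb{N}\}$ for any such $R$; $V(f)$ is independent of the choice of such $R$. A set $E\subset\mathbb{C}$ is a spider's web if it is connected and there is a sequence $(G_n)_{n\in\mathbb{N}}$ of bounded, simply connected domains such that $G_n\subset G_{n+1}$ and $\partial G_n\subset E$ for $n\in\mathbb{N}$, and $\bigcup_{n\in\mathbb{N}}G_n=\mathbb{C}$. *)

theory Defs
  imports "HOL-Complex_Analysis.Complex_Analysis"
begin

definition transcendental_entire :: "(complex \<Rightarrow> complex) \<Rightarrow> bool" where
  "transcendental_entire f \<longleftrightarrow>
     f holomorphic_on UNIV \<and> \<not> (\<exists>p :: complex poly. \<forall>z. f z = poly p z)"

text \<open>
  In the three moduli below, the supremum and the infimum are attained for continuous \<open>f\<close> and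
  \<open>r \<ge> 0\<close>, so they are the maximum and the minimum. For \<open>r < 0\<close> the index sets are empty and the
  values carry no meaning; iterates starting from \<open>r \<ge> 0\<close> never leave the nonnegative reals.
\<close>

definition max_modulus :: "(complex \<Rightarrow> complex) \<Rightarrow> real \<Rightarrow> real" where
  "max_modulus f r = (SUP z\<in>sphere 0 r. norm (f z))"

definition min_modulus :: "(complex \<Rightarrow> complex) \<Rightarrow> real \<Rightarrow> real" where
  "min_modulus f r = (INF z\<in>sphere 0 r. norm (f z))"

definition max_min_modulus :: "(complex \<Rightarrow> complex) \<Rightarrow> real \<Rightarrow> real" where
  "max_min_modulus f r = (SUP s\<in>{0..r}. min_modulus f s)"

text \<open>
  Normality is meant with respect to the spherical metric. On a domain, a locally uniform limit
  of holomorphic functions in that metric is either holomorphic or identically \<open>\<infinity>\<close>, which gives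
  the two alternatives below; the definition is intended for connected open \<open>U\<close> only.
\<close>

definition normal_family_on :: "complex set \<Rightarrow> (complex \<Rightarrow> complex) set \<Rightarrow> bool" where
  "normal_family_on U \<F> \<longleftrightarrow>
     (\<forall>s :: nat \<Rightarrow> complex \<Rightarrow> complex. (\<forall>k. s k \<in> \<F>) \<longrightarrow>
        (\<exists>\<sigma> :: nat \<Rightarrow> nat. strict_mono \<sigma> \<and>
           ((\<exists>g. g holomorphic_on U \<and>
               (\<forall>K. compact K \<and> K \<subseteq> U \<longrightarrow> uniform_limit K (\<lambda>k. s (\<sigma> k)) g sequentially)) \<or>
            (\<forall>K. compact K \<and> K \<subseteq> U \<longrightarrow>
               (\<forall>B :: real. \<forall>\<^sub>F k in sequentially. \<forall>z\<in>K. norm (s (\<sigma> k) z) > B)))))"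

definition Fatou_set :: "(complex \<Rightarrow> complex) \<Rightarrow> complex set" where
  "Fatou_set f =
     {z. \<exists>U. open U \<and> connected U \<and> z \<in> U \<and> normal_family_on U {f ^^ n | n. n \<ge> 1}}"

definition escaping_set :: "(complex \<Rightarrow> complex) \<Rightarrow> complex set" where
  "escaping_set f = {z. filterlim (\<lambda>n. (f ^^ n) z) at_infinity sequentially}"

definition fast_escaping_level :: "(complex \<Rightarrow> complex) \<Rightarrow> real \<Rightarrow> complex set" where
  "fast_escaping_level f R = {z. \<forall>n\<ge>1. norm ((f ^^ n) z) \<ge> (max_modulus f ^^ n) R}"

definition fast_escaping_radius :: "(complex \<Rightarrow> complex) \<Rightarrow> real \<Rightarrow> bool" where
  "fast_escaping_radius f R \<longleftrightarrow>
     R > 0 \<and> filterlim (\<lambda>n. (max_modulus f ^^ n) R) at_top sequentially"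

text \<open>
  The sets \<open>A(f)\<close> and \<open>V(f)\<close> do not depend on which admissible radius is used, so an arbitrary
  one is chosen.
\<close>

definition fast_escaping_set :: "(complex \<Rightarrow> complex) \<Rightarrow> complex set" where
  "fast_escaping_set f =
     (\<Union>l. (f ^^ l) -` fast_escaping_level f (SOME R. fast_escaping_radius f R))"

definition V_level :: "(complex \<Rightarrow> complex) \<Rightarrow> real \<Rightarrow> complex set" where
  "V_level f R = {z. \<forall>n\<ge>1. norm ((f ^^ n) z) \<ge> (max_min_modulus f ^^ n) R}"

definition V_radius :: "(complex \<Rightarrow> complex) \<Rightarrow> real \<Rightarrow> bool" where
  "V_radius f R \<longleftrightarrow> R > 0 \<and> (\<forall>r\<ge>R. max_min_modulus f r > r)"

definition V_set :: "(complex \<Rightarrow> complex) \<Rightarrow> complex set" where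
  "V_set f = (\<Union>l. (f ^^ l) -` V_level f (SOME R. V_radius f R))"

definition spiders_web :: "complex set \<Rightarrow> bool" where
  "spiders_web E \<longleftrightarrow> connected E \<and>
     (\<exists>G :: nat \<Rightarrow> complex set.
        (\<forall>n. open (G n) \<and> connected (G n) \<and> G n \<noteq> {} \<and> bounded (G n) \<and> simply_connected (G n) \<and>
             G n \<subseteq> G (Suc n) \<and> frontier (G n) \<subseteq> E) \<and>
        (\<Union>n. G n) = UNIV)"

end

theory Submission
  imports Defs
begin

text \<open>
  Write \<open>M\<close>, \<open>m\<close>, \<open>mt\<close> for the three moduli, where \<open>mt\<close> is the monotone majorant of \<open>m\<close>. By the
  intermediate value theorem some orbit of \<open>m\<close> grows as fast as one of \<open>mt\<close>, so the condition in (a) says that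
  the iterates of \<open>mt\<close> stay a bounded number of steps behind those of \<open>M\<close>, and then
  \<open>V(f) \<subseteq> A(f)\<close> is immediate.

  Conversely, call a point low if \<open>|f| \<le> 1\<close> there. If low points are sparse, then there are wide
  annuli free of them just inside every large circle, Harnack's inequality for \<open>ln |f|\<close> gives
  \<open>mt(r)\<close> almost as large as \<open>M(r)\<close>, and the loss is summable along the iteration. Otherwise, and if
  the iterates of \<open>mt\<close> lag arbitrarily far behind, a point of \<open>V(f)\<close> outside \<open>A(f)\<close> is found by
  itineraries through annuli bounded by iterates of \<open>M\<close>, each with a small disc removed: by Schottky's
  theorem the image of such a set can omit, in the next annulus, only points of a small disc, and near a
  low point the image reaches back to the preceding annulus. Going back infinitely often, but rarely
  enough, makes the orbit too slow for \<open>A(f)\<close> and still fast enough for \<open>V(f)\<close>.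

  For (b), a connected set joining \<open>0\<close> to the circle of radius \<open>r\<close> has a point with
  \<open>|f^n| \<ge> m^n(r) \<ge> M^n(R)\<close> for every \<open>n\<close>, so the component of \<open>0\<close> in the complement of a level set
  of \<open>A(f)\<close> is bounded. These components form the web. An unbounded Fatou component would meet
  their boundaries, and Harnack's inequality along the component contradicts the transcendental growth
  of \<open>M\<close>.
\<close>

subsection \<open>The maximum and minimum modulus\<close>

lemma complex_polar_unit:
  fixes z :: complex
  obtains w where "norm w = 1" "z = of_real (norm z) * w"
proof (cases "z = 0")
  case True
  then show ?thesis using that[of 1] by simp
next
  case False
  then show ?thesis using that[of "z / of_real (norm z)"] by (simp add: norm_divide)
qed

text \<open>Moving an extremal point radially to a nearby circle displaces it by the difference of
  the radii, so uniform continuity of \<open>u\<close> on a disc passes to \<open>g\<close>. It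
  serves \<open>M\<close> with \<open>u = |f|\<close> and \<open>m\<close> with
  \<open>u = -|f|\<close>.\<close>

lemma continuous_on_radial_max:
  fixes u :: "complex \<Rightarrow> real" and g :: "real \<Rightarrow> real"
  assumes u: "continuous_on UNIV u"
    and att: "\<And>r. r \<ge> 0 \<Longrightarrow> \<exists>z. norm z = r \<and> u z = g r"
    and le: "\<And>z. u z \<le> g (norm z)"
  shows "continuous_on {0..} g"
proof (rule continuous_onI)
  fix r0 e :: real
  assume r0: "r0 \<in> {0..}" and e: "0 < e"
  have "uniformly_continuous_on (cball 0 (r0 + 1)) u"
    by (rule compact_uniformly_continuous) (use u in \<open>auto intro: continuous_on_subset\<close>)
  then obtain d where d: "d > 0" "\<And>z z'. \<lbrakk>z \<in> cball 0 (r0+1); z' \<in> cball 0 (r0+1); dist z' z < d\<rbrakk> \<Longrightarrow> dist (u z') (u z) < e"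
    unfolding uniformly_continuous_on_def using e by metis
  have step: "g r \<le> g s + e" if "r \<ge> 0" "s \<ge> 0" "\<bar>r - s\<bar> < d" "r \<le> r0 + 1" "s \<le> r0 + 1" for r s
  proof -
    obtain z where z: "norm z = r" "u z = g r" using att[OF \<open>r \<ge> 0\<close>] by auto
    obtain w where w: "norm w = 1" "z = of_real (norm z) * w" by (rule complex_polar_unit)
    have nz: "norm (of_real s * w) = s" using w that by (simp add: norm_mult)
    have "norm (of_real s * w - z) = \<bar>s - r\<bar>"
    proof -
      have "of_real s * w - z = of_real (s - r) * w" using w z by (simp add: algebra_simps)
      then have "norm (of_real s * w - z) = norm (complex_of_real (s - r))" using w by (simp only: norm_mult)
      then show ?thesis by (simp only: norm_of_real)
    qed
    then have "dist (of_real s * w) z < d" using that by (simp add: dist_norm)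
    then have "dist (u (of_real s * w)) (u z) < e" using d(2)[of z "of_real s * w"] z nz that by simp
    then have "u z \<le> u (of_real s * w) + e" by (simp add: dist_real_def)
    also have "\<dots> \<le> g s + e" using le[of "of_real s * w"] nz by simp
    finally show ?thesis using z by simp
  qed
  show "\<exists>d>0. \<forall>x'\<in>{0..}. dist x' r0 < d \<longrightarrow> dist (g x') (g r0) \<le> e"
  proof (intro exI conjI ballI impI)
    show "min d 1 > 0" using d by simp
    fix r assume "r \<in> {0..}" "dist r r0 < min d 1"
    then have "\<bar>r - r0\<bar> < d" "r \<ge> 0" "r \<le> r0 + 1" by (auto simp: dist_real_def)
    then have "g r \<le> g r0 + e" "g r0 \<le> g r + e" using step[of r r0] step[of r0 r] r0 by auto
    then show "dist (g r) (g r0) \<le> e" by (auto simp: dist_real_def)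
  qed
qed

locale transcendental_map =
  fixes f :: "complex \<Rightarrow> complex"
  assumes transcendental: "transcendental_entire f"
begin

abbreviation "M \<equiv> max_modulus f"
abbreviation "m \<equiv> min_modulus f"
abbreviation "mt \<equiv> max_min_modulus f"

lemma holo: "f holomorphic_on A"
  using transcendental holomorphic_on_subset unfolding transcendental_entire_def by blast

lemma cont: "continuous_on A f"
  using holo by (rule holomorphic_on_imp_continuous_on)

lemma not_constant: "\<not> f constant_on UNIV"
proof
  assume "f constant_on UNIV"
  then obtain c where "\<And>z. f z = c" unfolding constant_on_def by auto
  then have "\<forall>z. f z = poly [:c:] z" by simp
  then show False using transcendental unfolding transcendental_entire_def by blast
qed

lemma max_modulus_attained:
  assumes "r \<ge> 0"
  shows "\<exists>z. norm z = r \<and> norm (f z) = M r" and "norm z = r \<Longrightarrow> norm (f z) \<le> M r"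
proof -
  have "\<exists>z\<in>sphere 0 r. \<forall>w\<in>sphere 0 r. norm (f w) \<le> norm (f z)"
    by (rule continuous_attains_sup) (use assms in \<open>auto intro!: continuous_intros cont\<close>)
  then obtain z0 where z: "norm z0 = r" "\<And>w. norm w = r \<Longrightarrow> norm (f w) \<le> norm (f z0)" by auto
  have "M r = norm (f z0)" unfolding max_modulus_def
    by (rule cSup_eq_maximum) (use z in auto)
  then show "\<exists>z. norm z = r \<and> norm (f z) = M r" "norm z = r \<Longrightarrow> norm (f z) \<le> M r"
    using z by auto
qed

lemma min_modulus_attained:
  assumes "r \<ge> 0"
  shows "\<exists>z. norm z = r \<and> norm (f z) = m r" and "norm z = r \<Longrightarrow> m r \<le> norm (f z)"
proof -
  have "\<exists>z\<in>sphere 0 r. \<forall>w\<in>sphere 0 r. norm (f z) \<le> norm (f w)"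
    by (rule continuous_attains_inf) (use assms in \<open>auto intro!: continuous_intros cont\<close>)
  then obtain z0 where z: "norm z0 = r" "\<And>w. norm w = r \<Longrightarrow> norm (f z0) \<le> norm (f w)" by auto
  have "m r = norm (f z0)" unfolding min_modulus_def
    by (rule cInf_eq_minimum) (use z in auto)
  then show "\<exists>z. norm z = r \<and> norm (f z) = m r" "norm z = r \<Longrightarrow> m r \<le> norm (f z)"
    using z by auto
qed

lemma norm_le_max_modulus:
  assumes "norm z \<le> r"
  shows "norm (f z) \<le> M r"
proof -
  have r: "r \<ge> 0" using assms norm_ge_zero[of z] by linarith
  show ?thesis
  proof (cases "r = 0")
    case True
    then show ?thesis using max_modulus_attained(2)[of r z] assms by auto
  next
    case False
    show ?thesis
    proof (rule maximum_modulus_frontier[where f = f and S = "cball 0 r" and \<xi> = z])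
      show "f holomorphic_on interior (cball 0 r)" "continuous_on (closure (cball 0 r)) f"
        by (rule holo cont)+
      show "norm (f w) \<le> M r" if "w \<in> frontier (cball 0 r)" for w
        using that max_modulus_attained(2)[OF r, of w] by simp
    qed (use assms in auto)
  qed
qed

lemma norm_less_max_modulus:
  assumes "norm z < r"
  shows "norm (f z) < M r"
proof (rule ccontr)
  assume "\<not> ?thesis"
  then have eq: "norm (f z) \<ge> M r" by simp
  have "f constant_on UNIV"
  proof (rule maximum_modulus_principle)
    show "norm (f w) \<le> norm (f z)" if "w \<in> ball 0 r" for w
      using norm_le_max_modulus[of w r] that eq by auto
  qed (use assms holo in auto)
  then show False using not_constant by simp
qed

lemma max_modulus_nonneg: "r \<ge> 0 \<Longrightarrow> M r \<ge> 0"
  using max_modulus_attained(1)[of r] by (metis norm_ge_zero)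

lemma max_modulus_strict_mono: "0 \<le> r \<Longrightarrow> r < s \<Longrightarrow> M r < M s"
  using max_modulus_attained(1)[of r] norm_less_max_modulus by metis

lemma max_modulus_mono: "0 \<le> r \<Longrightarrow> r \<le> s \<Longrightarrow> M r \<le> M s"
  using max_modulus_strict_mono[of r s] by (cases "r = s") auto

lemma max_modulus_pos: "0 < r \<Longrightarrow> M r > 0"
  using max_modulus_strict_mono[of 0 r] max_modulus_nonneg[of 0] by auto

lemma min_modulus_nonneg: "r \<ge> 0 \<Longrightarrow> m r \<ge> 0"
  using min_modulus_attained(1)[of r] by (metis norm_ge_zero)

lemma min_le_max_modulus: "r \<ge> 0 \<Longrightarrow> m r \<le> M r"
  using min_modulus_attained(1)[of r] max_modulus_attained(2)[of r] by metis

lemma continuous_on_max_modulus: "continuous_on {0..} M"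
  by (rule continuous_on_radial_max[of "\<lambda>z. norm (f z)"])
     (auto intro!: continuous_intros cont max_modulus_attained norm_le_max_modulus)

lemma continuous_on_min_modulus: "continuous_on {0..} m"
proof -
  have "continuous_on {0..} (\<lambda>r. - m r)"
  proof (rule continuous_on_radial_max[of "\<lambda>z. - norm (f z)"])
    show "\<exists>z. norm z = r \<and> - norm (f z) = - m r" if "r \<ge> 0" for r
      using min_modulus_attained(1)[OF that] by auto
    show "- norm (f z) \<le> - m (norm z)" for z
      using min_modulus_attained(2)[of "norm z" z] by simp
  qed (auto intro!: continuous_intros cont)
  from continuous_on_minus[OF this] show ?thesis by simp
qed

lemma bdd_above_min_modulus: "bdd_above (m ` {0..r})"
proof (rule bdd_aboveI2[where M = "M r"])
  fix s assume "s \<in> {0..r}"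
  then show "m s \<le> M r"
    using min_le_max_modulus[of s] max_modulus_mono[of s r] by auto
qed

lemma min_le_max_min_modulus: "0 \<le> s \<Longrightarrow> s \<le> r \<Longrightarrow> m s \<le> mt r"
  unfolding max_min_modulus_def by (rule cSUP_upper[OF _ bdd_above_min_modulus]) auto

lemma max_min_modulus_attained:
  assumes "r \<ge> 0"
  obtains s where "0 \<le> s" "s \<le> r" "m s = mt r"
proof -
  have "\<exists>s\<in>{0..r}. \<forall>t\<in>{0..r}. m t \<le> m s"
    by (rule continuous_attains_sup)
       (use assms in \<open>auto intro: continuous_on_subset[OF continuous_on_min_modulus]\<close>)
  then obtain s where s: "s \<in> {0..r}" "\<And>t. t \<in> {0..r} \<Longrightarrow> m t \<le> m s" by auto
  have "mt r = m s" unfolding max_min_modulus_def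
    by (rule cSup_eq_maximum) (use s in auto)
  then show ?thesis using that s by auto
qed

lemma max_min_modulus_mono: "0 \<le> r \<Longrightarrow> r \<le> s \<Longrightarrow> mt r \<le> mt s"
  by (metis max_min_modulus_attained min_le_max_min_modulus order_trans)

lemma max_min_modulus_nonneg: "0 \<le> r \<Longrightarrow> 0 \<le> mt r"
  by (metis max_min_modulus_attained min_modulus_nonneg)

lemma max_min_le_max_modulus: "0 \<le> r \<Longrightarrow> mt r \<le> M r"
  by (metis max_min_modulus_attained min_le_max_modulus max_modulus_mono order_trans)

lemma max_modulus_funpow_nonneg: "0 \<le> r \<Longrightarrow> 0 \<le> (M ^^ n) r"
  by (induction n) (auto simp: max_modulus_nonneg)

lemma min_modulus_funpow_nonneg: "0 \<le> r \<Longrightarrow> 0 \<le> (m ^^ n) r"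
  by (induction n) (auto simp: min_modulus_nonneg)

lemma max_min_modulus_funpow_nonneg: "0 \<le> r \<Longrightarrow> 0 \<le> (mt ^^ n) r"
  by (induction n) (auto simp: max_min_modulus_nonneg)

lemma max_modulus_funpow_mono: "0 \<le> r \<Longrightarrow> r \<le> s \<Longrightarrow> (M ^^ n) r \<le> (M ^^ n) s"
  by (induction n) (auto intro!: max_modulus_mono max_modulus_funpow_nonneg)

lemma max_min_modulus_funpow_mono: "0 \<le> r \<Longrightarrow> r \<le> s \<Longrightarrow> (mt ^^ n) r \<le> (mt ^^ n) s"
  by (induction n) (auto intro!: max_min_modulus_mono max_min_modulus_funpow_nonneg)

lemma max_min_le_max_modulus_funpow:
  assumes "0 \<le> r" "r \<le> s"
  shows "(mt ^^ n) r \<le> (M ^^ n) s"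
proof (induction n)
  case (Suc n)
  have "mt ((mt ^^ n) r) \<le> M ((mt ^^ n) r)"
    using assms max_min_modulus_funpow_nonneg by (intro max_min_le_max_modulus) auto
  also have "\<dots> \<le> M ((M ^^ n) s)"
    using Suc assms max_min_modulus_funpow_nonneg by (intro max_modulus_mono) auto
  finally show ?case by simp
qed (use assms in auto)

lemma min_le_max_min_modulus_funpow:
  assumes "0 \<le> r"
  shows "(m ^^ n) r \<le> (mt ^^ n) r"
proof (induction n)
  case (Suc n)
  then show ?case
    using assms min_modulus_funpow_nonneg[of r n] by (auto intro!: min_le_max_min_modulus)
qed auto

lemma norm_funpow_le_max_modulus: "norm z \<le> r \<Longrightarrow> norm ((f ^^ n) z) \<le> (M ^^ n) r"
  by (induction n) (auto intro!: norm_le_max_modulus)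

lemma norm_funpow_less_max_modulus: "norm z < r \<Longrightarrow> norm ((f ^^ n) z) < (M ^^ n) r"
  by (induction n) (auto intro!: norm_less_max_modulus)

lemma holo_funpow: "(f ^^ n) holomorphic_on A"
proof -
  have "(f ^^ n) holomorphic_on UNIV"
  proof (induction n)
    case (Suc n)
    show ?case using holomorphic_on_compose[OF Suc holo] by (simp add: o_def)
  qed (simp add: holomorphic_on_id[unfolded id_def])
  then show ?thesis using holomorphic_on_subset by blast
qed

lemma cont_funpow: "continuous_on A (f ^^ n)"
  using holo_funpow by (rule holomorphic_on_imp_continuous_on)

subsection \<open>Growth of the maximum modulus\<close>

text \<open>Hadamard's three circles theorem with inner radius 1. Since \<open>z^\<alpha>\<close> is
  multivalued, the maximum principle is applied to \<open>f^q / z^p\<close> with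
  \<open>p / q\<close> close to the slope \<open>\<alpha>\<close>, and then \<open>q\<close> tends
  to infinity.\<close>

lemma three_circles:
  assumes "1 \<le> r" "r \<le> R" "1 < R"
  shows "ln (M r) * ln R \<le> (ln R - ln r) * ln (M 1) + ln r * ln (M R)"
proof -
  define A where "A = ln (M 1)"
  define L where "L = ln R"
  define \<alpha> where "\<alpha> = (ln (M R) - A) / L"
  have M1: "M 1 > 0" and Mr: "M r > 0" and MR: "M R > 0" using assms by (auto intro!: max_modulus_pos)
  have L: "L > 0" using assms by (simp add: L_def)
  have \<alpha>: "\<alpha> \<ge> 0" unfolding \<alpha>_def A_def using L M1 MR max_modulus_mono[of 1 R] assms by auto
  have l: "ln r \<ge> 0" using assms by simp
  have key: "ln (M r) \<le> A + \<alpha> * ln r + ln r / real q" if q: "q \<ge> 1" for q :: nat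
  proof -
    \<comment> \<open>Rounding up keeps the bound valid on the outer circle; at radius
      \<open>r\<close> it costs at most the error \<open>ln r / q\<close>.\<close>
    define p where "p = nat \<lceil>real q * \<alpha>\<rceil>"
    have p: "real q * \<alpha> \<le> real p" "real p \<le> real q * \<alpha> + 1"
      unfolding p_def using \<alpha> by (simp_all add: of_nat_ceiling)
    obtain z where z: "norm z = r" "norm (f z) = M r" using max_modulus_attained(1)[of r] assms by auto
    define S where "S = {z::complex. 1 \<le> norm z \<and> norm z \<le> R}"
    define h where "h = (\<lambda>z. f z ^ q / z ^ p)"
    have S0: "0 \<notin> S" by (auto simp: S_def)
    have clS: "closed S" unfolding S_def
      by (auto intro!: closed_Collect_conj closed_Collect_le continuous_intros)
    have "norm (h z) \<le> exp (real q * A)"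
    proof (rule maximum_modulus_frontier[where f = h and S = S and \<xi> = z])
      show "h holomorphic_on interior S" unfolding h_def
        using S0 interior_subset[of S] by (auto intro!: holomorphic_intros holo)
      show "continuous_on (closure S) h" unfolding h_def closure_closed[OF clS]
        using S0 by (auto intro!: continuous_intros cont)
      show "bounded S" unfolding S_def bounded_iff by auto
      show "z \<in> S" using z assms by (auto simp: S_def)
      fix w assume w: "w \<in> frontier S"
      have "open {z::complex. 1 < norm z \<and> norm z < R}"
        by (auto intro!: open_Collect_conj open_Collect_less continuous_intros)
      then have "{z::complex. 1 < norm z \<and> norm z < R} \<subseteq> interior S"
        by (intro interior_maximal) (auto simp: S_def)
      then have "norm w = 1 \<or> norm w = R"
        using w clS by (force simp: frontier_def closure_closed S_def subset_iff)
      then show "norm (h w) \<le> exp (real q * A)"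
      proof
        assume "norm w = 1"
        then have "norm (h w) \<le> M 1 ^ q"
          using max_modulus_attained(2)[of 1 w] by (simp add: h_def norm_divide norm_power power_mono)
        also have "\<dots> = exp (real q * A)" using M1 by (simp add: A_def exp_of_nat_mult)
        finally show ?thesis .
      next
        assume wR: "norm w = R"
        have "norm (h w) = norm (f w) ^ q / R ^ p" using wR by (simp add: h_def norm_divide norm_power)
        also have "\<dots> \<le> M R ^ q / R ^ p"
          using max_modulus_attained(2)[of R w] wR assms by (intro divide_right_mono power_mono) auto
        also have "\<dots> = exp (real q * ln (M R) - real p * L)"
          using MR assms by (simp add: exp_diff exp_of_nat_mult L_def)
        also have "\<dots> \<le> exp (real q * A)"
        proof -
          have "ln (M R) = A + \<alpha> * L" using L by (simp add: \<alpha>_def)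
          then have "real q * ln (M R) - real p * L = real q * A + (real q * \<alpha> - real p) * L"
            by (simp add: algebra_simps)
          also have "\<dots> \<le> real q * A" using p L by (simp add: mult_nonpos_nonneg)
          finally show ?thesis by simp
        qed
        finally show ?thesis .
      qed
    qed
    then have "M r ^ q / r ^ p \<le> exp (real q * A)" using z by (simp add: h_def norm_divide norm_power)
    then have "ln (M r ^ q / r ^ p) \<le> real q * A"
      using Mr assms by (metis divide_pos_pos ln_exp ln_le_cancel_iff exp_gt_zero less_le_trans zero_less_one zero_less_power)
    then have "real q * ln (M r) - real p * ln r \<le> real q * A"
      using Mr assms by (simp add: ln_div ln_realpow)
    moreover have "real p * ln r \<le> (real q * \<alpha> + 1) * ln r" using p l by (intro mult_right_mono) auto
    ultimately have "real q * ln (M r) \<le> real q * A + (real q * \<alpha> + 1) * ln r" by linarith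
    also have "\<dots> = real q * (A + \<alpha> * ln r + ln r / real q)" using q by (simp add: field_simps)
    finally show ?thesis using q by simp
  qed
  have "(\<lambda>q. A + \<alpha> * ln r + ln r / real q) \<longlonglongrightarrow> A + \<alpha> * ln r + 0"
    by (intro tendsto_intros lim_const_over_n)
  moreover have "eventually (\<lambda>q. ln (M r) \<le> A + \<alpha> * ln r + ln r / real q) sequentially"
    using key eventually_ge_at_top[of 1] by (rule eventually_mono[rotated]) auto
  ultimately have "ln (M r) \<le> A + \<alpha> * ln r + 0" using tendsto_lowerbound[of _ _ sequentially] by (simp add: tendsto_lowerbound)
  then have "ln (M r) * L \<le> (A + \<alpha> * ln r) * L" using L by simp
  also have "\<dots> = A * L + ln r * (\<alpha> * L)" by (simp add: algebra_simps)
  also have "\<alpha> * L = ln (M R) - A" using L by (simp add: \<alpha>_def)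
  finally show ?thesis by (simp add: A_def L_def algebra_simps)
qed

text \<open>In the coordinate \<open>t = ln r\<close> the map \<open>M\<close> becomes
  \<open>log_max\<close>, for which Hadamard's theorem is a convexity statement.\<close>

definition log_max :: "real \<Rightarrow> real" where
  "log_max t = ln (M (exp t))"

lemma exp_log_max: "exp (log_max t) = M (exp t)"
  unfolding log_max_def using max_modulus_pos[of "exp t"] by simp

lemma log_max_mono: "s \<le> t \<Longrightarrow> log_max s \<le> log_max t"
  unfolding log_max_def using max_modulus_mono[of "exp s" "exp t"] max_modulus_pos[of "exp s"] by simp

text \<open>Hadamard's theorem as monotonicity of the chord slopes from 0, multiplied out so that no
  division by \<open>s\<close> or \<open>t\<close> occurs.\<close>

lemma log_max_convex0:
  assumes "0 \<le> s" "s \<le> t"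
  shows "t * (log_max s - log_max 0) \<le> s * (log_max t - log_max 0)"
proof (cases "t = 0")
  case False
  then show ?thesis
    using three_circles[of "exp s" "exp t"] assms by (simp add: log_max_def algebra_simps)
qed (use assms in auto)

text \<open>If \<open>f\<close> were bounded by a power of \<open>|z|\<close> far out, Liouville's
  theorem would make it a polynomial. So some circle carries growth beyond any given power, and the
  chord slopes carry this to all larger circles.\<close>

lemma log_max_superlinear: "\<exists>t0. \<forall>t\<ge>t0. K * t \<le> log_max t"
proof -
  \<comment> \<open>The two copies of \<open>|log_max 0|\<close> absorb the offset at 0, once at
    \<open>s\<close> and once at \<open>t\<close>.\<close>
  define N where "N = nat \<lceil>\<bar>K\<bar> + 2 * \<bar>log_max 0\<bar> + 1\<rceil>"
  have N: "real N \<ge> \<bar>K\<bar> + 2 * \<bar>log_max 0\<bar> + 1" unfolding N_def by linarith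
  \<comment> \<open>The bound 3 exceeds \<open>exp 1\<close>, which makes
    \<open>s = ln (norm z)\<close> at least 1.\<close>
  have "\<exists>z. 3 \<le> norm z \<and> norm (f z) > norm z ^ N"
  proof (rule ccontr)
    assume "\<not> ?thesis"
    then have le: "norm (f z) \<le> 1 * norm z ^ N" if "3 \<le> norm z" for z using that by force
    have eq: "f \<xi> = (\<Sum>k\<le>N. (deriv ^^ k) f 0 / fact k * \<xi> ^ k)" for \<xi>
      by (rule Liouville_polynomial[OF holo le])
    have "f \<xi> = poly (\<Sum>k\<le>N. monom ((deriv ^^ k) f 0 / fact k) k) \<xi>" for \<xi>
      unfolding eq[of \<xi>] by (simp add: poly_sum poly_monom)
    then show False using transcendental unfolding transcendental_entire_def by blast
  qed
  then obtain z where z: "3 \<le> norm z" "norm (f z) > norm z ^ N" by auto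
  define s where "s = ln (norm z)"
  have s1: "s \<ge> 1" unfolding s_def using z exp_le by (subst ln_ge_iff) auto
  have es: "exp s = norm z" using z unfolding s_def by (subst exp_ln) auto
  have "exp (real N * s) \<le> exp (log_max s)"
    unfolding exp_log_max es exp_of_nat_mult using z norm_le_max_modulus[of z "norm z"] by simp
  then have Ns: "real N * s \<le> log_max s" by simp
  show ?thesis
  proof (intro exI allI impI)
    fix t assume t: "t \<ge> s"
    have "s * (real N - \<bar>log_max 0\<bar>) \<le> log_max s - log_max 0"
      using Ns mult_right_mono[OF s1, of "\<bar>log_max 0\<bar>"] by (simp add: algebra_simps)
    then have "t * (s * (real N - \<bar>log_max 0\<bar>)) \<le> t * (log_max s - log_max 0)"
      using s1 t by (intro mult_left_mono) auto
    also have "\<dots> \<le> s * (log_max t - log_max 0)"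
      using log_max_convex0[of s t] s1 t by auto
    finally have "s * (t * (real N - \<bar>log_max 0\<bar>)) \<le> s * (log_max t - log_max 0)"
      by (simp add: algebra_simps)
    then have 1: "t * (real N - \<bar>log_max 0\<bar>) \<le> log_max t - log_max 0" using s1 by simp
    have "t * K + t * \<bar>log_max 0\<bar> \<le> t * (real N - \<bar>log_max 0\<bar>)"
      using N s1 t by (subst distrib_left[symmetric], intro mult_left_mono) auto
    moreover have "\<bar>log_max 0\<bar> \<le> t * \<bar>log_max 0\<bar>" using s1 t mult_right_mono[of 1 t "\<bar>log_max 0\<bar>"] by auto
    ultimately show "K * t \<le> log_max t" using 1 by (simp add: mult.commute)
  qed
qed

text \<open>A chord from 0 that is already steep at \<open>ln r\<close> forces at least its slope on
  the further step of length \<open>ln k\<close>, so \<open>log_max\<close> gains more than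
  \<open>ln C\<close> there.\<close>

lemma max_modulus_ratio:
  assumes "k > 1"
  shows "\<exists>r0>0. \<forall>r\<ge>r0. C * M r \<le> M (k * r)"
proof -
  define \<kappa> where "\<kappa> = ln k"
  have \<kappa>: "\<kappa> > 0" using assms by (simp add: \<kappa>_def)
  define c where "c = ln (max C 1)"
  obtain t0 where t0: "\<And>t. t \<ge> t0 \<Longrightarrow> ((\<bar>c\<bar> + 1) / \<kappa> + \<bar>log_max 0\<bar>) * t \<le> log_max t"
    using log_max_superlinear by blast
  show ?thesis
  proof (intro exI[of _ "exp (max t0 1)"] conjI allI impI)
    fix r assume r: "exp (max t0 1) \<le> r"
    define t where "t = ln r"
    have rp: "r > 0" using r less_le_trans[OF exp_gt_zero] by blast
    have "exp t0 \<le> r" "exp 1 \<le> r" using r order_trans[OF _ r] by simp_all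
    then have t: "t \<ge> t0" "t \<ge> 1" using rp by (simp_all add: t_def ln_ge_iff)
    have "(t + \<kappa>) * (log_max t - log_max 0) \<le> t * (log_max (t + \<kappa>) - log_max 0)"
      using log_max_convex0[of t "t + \<kappa>"] t \<kappa> by auto
    then have 1: "\<kappa> * (log_max t - log_max 0) \<le> t * (log_max (t + \<kappa>) - log_max t)"
      by (simp add: algebra_simps)
    have "((\<bar>c\<bar> + 1) / \<kappa>) * t + \<bar>log_max 0\<bar> \<le> ((\<bar>c\<bar> + 1) / \<kappa>) * t + \<bar>log_max 0\<bar> * t"
      using t mult_left_mono[of 1 t "\<bar>log_max 0\<bar>"] by auto
    also have "\<dots> \<le> log_max t" using t0[OF t(1)] by (simp add: algebra_simps)
    finally have "((\<bar>c\<bar> + 1) / \<kappa>) * t \<le> log_max t - log_max 0" by linarith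
    then have "\<kappa> * (((\<bar>c\<bar> + 1) / \<kappa>) * t) \<le> \<kappa> * (log_max t - log_max 0)"
      using \<kappa> by (intro mult_left_mono) auto
    with 1 have "t * (\<bar>c\<bar> + 1) \<le> t * (log_max (t + \<kappa>) - log_max t)" using \<kappa> by (simp add: mult.commute)
    then have "\<bar>c\<bar> + 1 \<le> log_max (t + \<kappa>) - log_max t" using t by simp
    then have "exp (c + log_max t) \<le> exp (log_max (t + \<kappa>))" by simp
    then have "exp c * M r \<le> M (k * r)"
      using rp assms by (simp add: exp_add exp_log_max t_def \<kappa>_def mult.commute)
    moreover have "C * M r \<le> exp c * M r"
      using max_modulus_pos[OF rp] by (intro mult_right_mono) (auto simp: c_def)
    ultimately show "C * M r \<le> M (k * r)" by linarith
  qed auto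
qed

lemma max_modulus_power: "\<exists>r0. \<forall>r\<ge>r0. r ^ N \<le> M r"
proof -
  obtain t0 where t0: "\<And>t. t \<ge> t0 \<Longrightarrow> real N * t \<le> log_max t"
    using log_max_superlinear by blast
  show ?thesis
  proof (intro exI[of _ "exp t0"] allI impI)
    fix r assume r: "exp t0 \<le> r"
    have rp: "r > 0" using r less_le_trans[OF exp_gt_zero] by blast
    have "exp (real N * ln r) \<le> exp (log_max (ln r))"
      using t0[of "ln r"] r rp by (simp add: ln_ge_iff)
    then show "r ^ N \<le> M r" using rp by (simp add: exp_of_nat_mult exp_log_max)
  qed
qed

lemma max_modulus_surj:
  assumes "M 0 \<le> q"
  obtains r where "r \<ge> 0" "M r = q"
proof -
  obtain r0 where r0: "\<And>r. r \<ge> r0 \<Longrightarrow> r ^ 1 \<le> M r" using max_modulus_power by blast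
  define b where "b = max (max r0 q) 0"
  have "q \<le> M b" using r0[of b] by (auto simp: b_def)
  then obtain r where "0 \<le> r" "r \<le> b" "M r = q"
    using IVT'[of M 0 q b] assms continuous_on_subset[OF continuous_on_max_modulus, of "{0..b}"]
    by (auto simp: b_def)
  then show ?thesis using that by auto
qed

lemma max_modulus_le_cancel: "0 \<le> s \<Longrightarrow> 0 \<le> r \<Longrightarrow> M r \<le> M s \<Longrightarrow> r \<le> s"
  using max_modulus_strict_mono[of s r] by force

end

subsection \<open>Iterated moduli and independence of the radius\<close>

text \<open>Points that follow the itinerary for \<open>n\<close> steps form a decreasing sequence
  of compact sets, nonempty because the last set can be pulled back through the coverings. It yields
  orbits of \<open>m\<close> on the line and of \<open>f\<close> in the plane.\<close>

lemma compact_orbit_exists: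
  fixes g :: "'a::heine_borel \<Rightarrow> 'a" and E :: "nat \<Rightarrow> 'a set"
  assumes compact: "\<And>n. compact (E n)" and ne: "\<And>n. E n \<noteq> {}"
    and cont: "continuous_on UNIV g" and cover: "\<And>n. E (Suc n) \<subseteq> g ` E n"
  shows "\<exists>z. \<forall>n. (g ^^ n) z \<in> E n"
proof -
  define K where "K n = E 0 \<inter> (\<Inter>i\<in>{..n}. (g ^^ i) -` E i)" for n
  have contn: "continuous_on UNIV (g ^^ n)" for n
  proof (induction n)
    case (Suc n)
    have "continuous_on UNIV (g \<circ> (g ^^ n))"
      by (rule continuous_on_compose[OF Suc continuous_on_subset[OF cont]]) simp
    then show ?case by (simp add: o_def)
  qed (simp add: id_def)
  have "\<Inter>(range K) \<noteq> {}"
  proof (rule compact_nest)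
    show "compact (K n)" for n
    proof -
      have "closed ((g ^^ i) -` E i)" for i
        by (rule closed_vimage[OF compact_imp_closed[OF compact] contn])
      then show ?thesis unfolding K_def by (intro compact_Int_closed compact closed_INT) auto
    qed
    have "\<exists>z. (\<forall>i\<le>n. (g ^^ i) z \<in> E i) \<and> (g ^^ n) z = w" if "w \<in> E n" for n w
      using that
    proof (induction n arbitrary: w)
      case (Suc n)
      then obtain v where v: "v \<in> E n" "w = g v" using cover by blast
      then obtain z where z: "\<forall>i\<le>n. (g ^^ i) z \<in> E i" "(g ^^ n) z = v" using Suc.IH by blast
      then show ?case using v Suc.prems by (intro exI[of _ z]) (auto simp: le_Suc_eq)
    qed auto
    then show "K n \<noteq> {}" for n
    proof -
      obtain w where "w \<in> E n" using ne by blast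
      then obtain z where z: "\<forall>i\<le>n. (g ^^ i) z \<in> E i"
        using \<open>\<And>w n. w \<in> E n \<Longrightarrow> \<exists>z. (\<forall>i\<le>n. (g ^^ i) z \<in> E i) \<and> (g ^^ n) z = w\<close> by blast
      then have "z \<in> K n" unfolding K_def by (auto dest: spec[of _ 0])
      then show ?thesis by blast
    qed
    show "K n \<subseteq> K k" if "k \<le> n" for k n using that unfolding K_def by force
  qed
  then obtain z where z: "\<And>n. z \<in> K n" by auto
  have "(g ^^ n) z \<in> E n" for n using z[of n] unfolding K_def by auto
  then show ?thesis by blast
qed

lemma filterlim_at_top_obtains:
  fixes X :: "nat \<Rightarrow> real"
  assumes "filterlim X at_top sequentially"
  obtains k where "X k \<ge> c"
proof -
  have "eventually (\<lambda>n. c \<le> X n) sequentially" using assms unfolding filterlim_at_top by blast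
  then obtain k where "c \<le> X k" unfolding eventually_sequentially by blast
  then show ?thesis by (rule that)
qed

context transcendental_map begin

lemma V_radius_mono: "V_radius f R \<Longrightarrow> R \<le> R' \<Longrightarrow> V_radius f R'"
  unfolding V_radius_def by auto

text \<open>If \<open>mt r \<le> r\<close> for some \<open>r \<ge> \<rho>\<close>, then
  \<open>m\<close> maps \<open>[0, r]\<close> into itself and traps the orbit of
  \<open>\<rho>\<close>.\<close>

lemma V_radius_exists:
  assumes "\<rho> > 0" "filterlim (\<lambda>n. (m ^^ n) \<rho>) at_top sequentially"
  shows "V_radius f \<rho>"
proof -
  have "mt r > r" if r: "r \<ge> \<rho>" for r
  proof (rule ccontr)
    assume "\<not> ?thesis"
    then have le: "mt r \<le> r" by simp
    have bd: "(m ^^ n) \<rho> \<le> r" for n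
    proof (induction n)
      case (Suc n)
      have "m ((m ^^ n) \<rho>) \<le> mt r"
        using Suc assms min_modulus_funpow_nonneg by (intro min_le_max_min_modulus) auto
      then show ?case using le by simp
    qed (use r in auto)
    obtain k where "(m ^^ k) \<rho> \<ge> r + 1" using filterlim_at_top_obtains[OF assms(2)] .
    with bd[of k] show False by simp
  qed
  then show ?thesis using assms by (auto simp: V_radius_def)
qed

lemma V_radius_incseq:
  assumes "V_radius f R"
  shows "R \<le> (mt ^^ n) R" and "(mt ^^ n) R \<le> (mt ^^ Suc n) R"
proof -
  have 1: "R \<le> (mt ^^ n) R" for n
  proof (induction n)
    case (Suc n)
    then show ?case using assms unfolding V_radius_def by (auto intro: less_imp_le order_trans)
  qed auto
  then show "R \<le> (mt ^^ n) R" "(mt ^^ n) R \<le> (mt ^^ Suc n) R"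
    using assms unfolding V_radius_def by (auto intro: less_imp_le)
qed

lemma max_min_modulus_funpow_le:
  assumes "V_radius f R" "k \<le> n"
  shows "(mt ^^ k) R \<le> (mt ^^ n) R"
  using lift_Suc_mono_le[of "\<lambda>n. (mt ^^ n) R", OF V_radius_incseq(2)[OF assms(1)] assms(2)] .

lemma max_min_modulus_funpow_tendsto:
  assumes V: "V_radius f R"
  shows "filterlim (\<lambda>n. (mt ^^ n) R) at_top sequentially"
proof -
  define x where "x n = (mt ^^ n) R" for n
  have R: "R > 0" using V by (simp add: V_radius_def)
  have inc: "incseq x" unfolding x_def using max_min_modulus_funpow_le[OF V] by (auto simp: incseq_def)
  have "\<exists>N. x N \<ge> Z" for Z
  proof (rule ccontr)
    assume "\<not> ?thesis"
    then have "x n \<le> Z" for n by (auto simp: not_le intro: less_imp_le)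
    then obtain L where L: "x \<longlonglongrightarrow> L" "\<forall>n. x n \<le> L"
      using incseq_convergent[OF inc] by blast
    have "R \<le> L" using L(2)[rule_format, of 0] by (simp add: x_def)
    then have "mt L > L" using V by (auto simp: V_radius_def)
    moreover obtain s where s: "0 \<le> s" "s \<le> L" "m s = mt L"
      using max_min_modulus_attained[of L] \<open>R \<le> L\<close> R by auto
    \<comment> \<open>Continuity of \<open>m\<close> suffices: truncating the maximising radius
      \<open>s\<close> at \<open>x n\<close> gives radii that tend to \<open>s\<close>, and there
      \<open>m\<close> is at most \<open>mt (x n) = x (Suc n) \<le> L\<close>.\<close>
    have "(\<lambda>n. min s (x n)) \<longlonglongrightarrow> min s L" by (intro tendsto_intros L)
    then have ys: "(\<lambda>n. min s (x n)) \<longlonglongrightarrow> s" using s by simp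
    have x0: "x n \<ge> 0" for n using V_radius_incseq(1)[OF V, of n] R by (simp add: x_def)
    have "(\<lambda>n. m (min s (x n))) \<longlonglongrightarrow> m s"
      by (rule continuous_on_tendsto_compose[OF continuous_on_min_modulus ys]) (use s x0 in auto)
    moreover have "m (min s (x n)) \<le> L" for n
    proof -
      have "m (min s (x n)) \<le> mt (x n)" using s x0 by (intro min_le_max_min_modulus) auto
      also have "\<dots> = x (Suc n)" by (simp add: x_def)
      finally show ?thesis using L(2) by (meson order_trans)
    qed
    ultimately have "m s \<le> L" by (meson LIMSEQ_le_const2)
    then show False using \<open>mt L > L\<close> s by simp
  qed
  then show ?thesis
    unfolding filterlim_at_top eventually_sequentially x_def[symmetric]
    using inc by (meson incseqD order_trans)
qed

section \<open>Independence of the admissible radius\<close>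

lemma fast_escaping_radiusI_V:
  assumes "V_radius f R"
  shows "fast_escaping_radius f R"
proof -
  have R: "R > 0" using assms by (simp add: V_radius_def)
  have "filterlim (\<lambda>n. (M ^^ n) R) at_top sequentially"
    by (rule filterlim_at_top_mono[OF max_min_modulus_funpow_tendsto[OF assms]])
       (use R in \<open>auto intro!: always_eventually max_min_le_max_modulus_funpow\<close>)
  with R show ?thesis by (simp add: fast_escaping_radius_def)
qed

text \<open>Once \<open>M^k(R)\<close> passes \<open>R'\<close>, \<open>k\<close> further iterations
  turn the bound from \<open>R\<close> into one from \<open>R'\<close>. Applied both ways, this
  frees the definition from the choice made by \<open>SOME\<close>.\<close>

lemma fast_escaping_level_subset:
  assumes "fast_escaping_radius f R" "fast_escaping_radius f R'"
  shows "(\<Union>l. (f ^^ l) -` fast_escaping_level f R) \<subseteq> (\<Union>l. (f ^^ l) -` fast_escaping_level f R')"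
proof
  fix z assume "z \<in> (\<Union>l. (f ^^ l) -` fast_escaping_level f R)"
  then obtain l where l: "\<And>n. n \<ge> 1 \<Longrightarrow> norm ((f ^^ n) ((f ^^ l) z)) \<ge> (M ^^ n) R"
    by (auto simp: fast_escaping_level_def)
  obtain k where k: "(M ^^ k) R \<ge> R'"
    using assms(1) unfolding fast_escaping_radius_def by (auto elim: filterlim_at_top_obtains)
  have "norm ((f ^^ n) ((f ^^ (k + l)) z)) \<ge> (M ^^ n) R'" if "n \<ge> 1" for n
  proof -
    have "(M ^^ n) R' \<le> (M ^^ n) ((M ^^ k) R)"
      using k assms(2) by (intro max_modulus_funpow_mono) (auto simp: fast_escaping_radius_def)
    also have "\<dots> = (M ^^ (n + k)) R" by (simp add: funpow_add)
    also have "\<dots> \<le> norm ((f ^^ (n + k)) ((f ^^ l) z))" using l that by simp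
    finally show ?thesis by (simp add: funpow_add)
  qed
  then show "z \<in> (\<Union>l. (f ^^ l) -` fast_escaping_level f R')"
    by (auto simp: fast_escaping_level_def)
qed

lemma fast_escaping_set_eq:
  assumes "fast_escaping_radius f R"
  shows "fast_escaping_set f = (\<Union>l. (f ^^ l) -` fast_escaping_level f R)"
proof -
  have "fast_escaping_radius f (SOME R. fast_escaping_radius f R)" using assms by (rule someI)
  from fast_escaping_level_subset[OF assms this] fast_escaping_level_subset[OF this assms]
  show ?thesis unfolding fast_escaping_set_def by (rule equalityI[rotated])
qed

lemma V_level_subset:
  assumes "V_radius f R" "V_radius f R'"
  shows "(\<Union>l. (f ^^ l) -` V_level f R) \<subseteq> (\<Union>l. (f ^^ l) -` V_level f R')"
proof
  fix z assume "z \<in> (\<Union>l. (f ^^ l) -` V_level f R)"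
  then obtain l where l: "\<And>n. n \<ge> 1 \<Longrightarrow> norm ((f ^^ n) ((f ^^ l) z)) \<ge> (mt ^^ n) R"
    by (auto simp: V_level_def)
  obtain k where k: "(mt ^^ k) R \<ge> R'"
    using max_min_modulus_funpow_tendsto[OF assms(1)] by (auto elim: filterlim_at_top_obtains)
  have "norm ((f ^^ n) ((f ^^ (k + l)) z)) \<ge> (mt ^^ n) R'" if "n \<ge> 1" for n
  proof -
    have "(mt ^^ n) R' \<le> (mt ^^ n) ((mt ^^ k) R)"
      using k assms(2) by (intro max_min_modulus_funpow_mono) (auto simp: V_radius_def)
    also have "\<dots> = (mt ^^ (n + k)) R" by (simp add: funpow_add)
    also have "\<dots> \<le> norm ((f ^^ (n + k)) ((f ^^ l) z))" using l that by simp
    finally show ?thesis by (simp add: funpow_add)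
  qed
  then show "z \<in> (\<Union>l. (f ^^ l) -` V_level f R')"
    by (auto simp: V_level_def)
qed

lemma V_set_eq:
  assumes "V_radius f R"
  shows "V_set f = (\<Union>l. (f ^^ l) -` V_level f R)"
proof -
  have "V_radius f (SOME R. V_radius f R)" using assms by (rule someI)
  from V_level_subset[OF assms this] V_level_subset[OF this assms]
  show ?thesis unfolding V_set_def by (rule equalityI[rotated])
qed

lemma fast_escaping_subset_V:
  assumes "V_radius f R"
  shows "fast_escaping_set f \<subseteq> V_set f"
proof -
  have "fast_escaping_level f R \<subseteq> V_level f R"
    using max_min_le_max_modulus_funpow[of R R] assms
    by (fastforce simp: fast_escaping_level_def V_level_def V_radius_def intro: order_trans)
  then show ?thesis
    unfolding fast_escaping_set_eq[OF fast_escaping_radiusI_V[OF assms]] V_set_eq[OF assms] by blast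
qed

text \<open>Since \<open>m \<le> mt\<close>, the hypothesis bounds \<open>M^n(R)\<close> by
  \<open>mt^n(r)\<close>, and \<open>r\<close> is overtaken by some \<open>mt^k(\<rho>)\<close>; the
  delay \<open>k\<close> is absorbed in the preimage index.\<close>

lemma V_subset_fast_escaping:
  assumes V: "V_radius f \<rho>" and "r \<ge> R" "R > 0"
    and le: "\<And>n. n \<ge> 1 \<Longrightarrow> (m ^^ n) r \<ge> (M ^^ n) R"
    and lim: "filterlim (\<lambda>n. (M ^^ n) R) at_top sequentially"
  shows "V_set f \<subseteq> fast_escaping_set f"
proof
  have A: "fast_escaping_radius f R" using assms by (simp add: fast_escaping_radius_def)
  fix z assume "z \<in> V_set f"
  then obtain l where l: "\<And>n. n \<ge> 1 \<Longrightarrow> norm ((f ^^ n) ((f ^^ l) z)) \<ge> (mt ^^ n) \<rho>"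
    unfolding V_set_eq[OF V] by (auto simp: V_level_def)
  obtain k where k: "(mt ^^ k) \<rho> \<ge> r"
    using max_min_modulus_funpow_tendsto[OF V] by (auto elim: filterlim_at_top_obtains)
  have "norm ((f ^^ n) ((f ^^ (k + l)) z)) \<ge> (M ^^ n) R" if "n \<ge> 1" for n
  proof -
    have "(M ^^ n) R \<le> (mt ^^ n) r"
      using le[OF that] min_le_max_min_modulus_funpow[of r n] assms by linarith
    also have "\<dots> \<le> (mt ^^ n) ((mt ^^ k) \<rho>)"
      using k assms by (intro max_min_modulus_funpow_mono) auto
    also have "\<dots> = (mt ^^ (n + k)) \<rho>" by (simp add: funpow_add)
    also have "\<dots> \<le> norm ((f ^^ (n + k)) ((f ^^ l) z))" using l that by simp
    finally show ?thesis by (simp add: funpow_add)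
  qed
  then show "z \<in> fast_escaping_set f"
    unfolding fast_escaping_set_eq[OF A] by (auto simp: fast_escaping_level_def)
qed

text \<open>By the intermediate value theorem, \<open>m\<close> maps the interval between consecutive iterates
  of the monotone majorant over the next such interval, so some orbit of \<open>m\<close> visits them all.\<close>

lemma min_modulus_orbit:
  assumes V: "V_radius f R"
  obtains t where "t \<ge> R" "\<And>n. (m ^^ n) t \<ge> (mt ^^ n) R"
proof -
  define x where "x n = (mt ^^ n) R" for n
  have R: "R > 0" using V by (simp add: V_radius_def)
  have x0: "x n \<ge> R" "x n \<le> x (Suc n)" for n
    using V_radius_incseq[OF V] by (auto simp: x_def)
  \<comment> \<open>The absolute value extends \<open>m\<close> continuously to the whole line;
    along the orbit found it changes nothing.\<close>
  have "\<exists>z. \<forall>n. ((\<lambda>t. m \<bar>t\<bar>) ^^ n) z \<in> {x n..x (Suc n)}"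
  proof (rule compact_orbit_exists)
    show "continuous_on UNIV (\<lambda>t. m \<bar>t\<bar>)"
      by (rule continuous_on_compose2[OF continuous_on_min_modulus]) (auto intro!: continuous_intros)
    show "{x n..x (Suc n)} \<noteq> {}" for n using x0 by simp
    show "{x (Suc n)..x (Suc (Suc n))} \<subseteq> (\<lambda>t. m \<bar>t\<bar>) ` {x n..x (Suc n)}" for n
    proof
      fix u assume u: "u \<in> {x (Suc n)..x (Suc (Suc n))}"
      obtain s where s: "0 \<le> s" "s \<le> x (Suc n)" "m s = x (Suc (Suc n))"
        using max_min_modulus_attained[of "x (Suc n)"] x0(1)[of "Suc n"] R by (auto simp: x_def)
      \<comment> \<open>On \<open>[0, x n]\<close> the values of \<open>m\<close> are at most
        \<open>x (Suc n)\<close>, which is less than \<open>x (Suc (Suc n))\<close>.\<close>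
      have xs: "x n \<le> s"
      proof (rule ccontr)
        assume "\<not> x n \<le> s"
        then have "m s \<le> x (Suc n)" using min_le_max_min_modulus[of s "x n"] s by (simp add: x_def)
        moreover have "x (Suc n) < x (Suc (Suc n))"
          using V x0(1)[of "Suc n"] by (simp add: x_def V_radius_def)
        ultimately show False using s by simp
      qed
      have "m (x n) \<le> x (Suc n)" using min_le_max_min_modulus[of "x n" "x n"] x0(1)[of n] R by (simp add: x_def)
      then obtain t where "x n \<le> t" "t \<le> s" "m t = u"
        using IVT'[of m "x n" u s] xs u s x0(1)[of n] R
          continuous_on_subset[OF continuous_on_min_modulus, of "{x n..s}"] by auto
      then show "u \<in> (\<lambda>t. m \<bar>t\<bar>) ` {x n..x (Suc n)}"
        using s x0(1)[of n] R by (intro image_eqI[of _ _ t]) auto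
    qed
  qed auto
  then obtain t where t: "\<And>n. ((\<lambda>t. m \<bar>t\<bar>) ^^ n) t \<in> {x n..x (Suc n)}" by blast
  have "((\<lambda>t. m \<bar>t\<bar>) ^^ n) t = (m ^^ n) t" for n
  proof (induction n)
    case (Suc n)
    have "((\<lambda>t. m \<bar>t\<bar>) ^^ n) t \<ge> 0" using t[of n] x0(1)[of n] R by auto
    then show ?case using Suc by simp
  qed auto
  then have "(m ^^ n) t \<ge> (mt ^^ n) R" for n using t[of n] by (simp add: x_def)
  then show ?thesis using that[of t] by (metis funpow_0)
qed

text \<open>Reduces necessity in (a) to comparing iterates of \<open>M\<close> and
  \<open>mt\<close>, as an orbit of \<open>m\<close> from \<open>min_modulus_orbit\<close> dominates
  that of \<open>mt\<close>.\<close>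

lemma iterated_min_modulus_of_le:
  assumes "V_radius f R1" "R2 > 0" "R2 \<le> R1" "filterlim (\<lambda>n. (M ^^ n) R2) at_top sequentially"
    and le: "\<And>n. (M ^^ n) R2 \<le> (mt ^^ n) R1"
  shows "\<exists>r R. r \<ge> R \<and> R > 0 \<and> (\<forall>n\<ge>1. (m ^^ n) r \<ge> (M ^^ n) R) \<and>
               filterlim (\<lambda>n. (M ^^ n) R) at_top sequentially"
proof -
  obtain t where t: "t \<ge> R1" "\<And>n. (m ^^ n) t \<ge> (mt ^^ n) R1" using min_modulus_orbit[OF assms(1)] by blast
  show ?thesis
    by (rule exI[of _ t], rule exI[of _ R2]) (use assms t le in \<open>auto intro: order_trans\<close>)
qed

end

subsection \<open>Pairs of omitted values\<close>

text \<open>Schottky's theorem rescaled to a disc; at relative radius \<open>t = 2/3\<close> its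
  term \<open>12 * t / (1 - t)\<close> equals 24.\<close>

lemma schottky_ball:
  assumes g: "g holomorphic_on cball u d" and d: "d > 0"
    and om: "\<And>z. z \<in> cball u d \<Longrightarrow> g z \<noteq> 0 \<and> g z \<noteq> 1"
    and B: "norm (g u) \<le> B" and z: "dist u z \<le> 2/3 * d"
  shows "norm (g z) \<le> exp (pi * exp (pi * (2 + 2 * B + 24)))"
proof -
  define h where "h = (\<lambda>\<zeta>. g (u + of_real d * \<zeta>))"
  have sub: "u + of_real d * \<zeta> \<in> cball u d" if "\<zeta> \<in> cball 0 1" for \<zeta>
    using that d by (auto simp: dist_norm norm_mult)
  have "norm (h ((z - u) / of_real d)) \<le> exp (pi * exp (pi * (2 + 2 * B + 12 * (2/3) / (1 - 2/3))))"
  proof (rule Schottky[where f = h and z = "(z - u) / of_real d"])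
    show "h holomorphic_on cball 0 1" unfolding h_def
      by (rule holomorphic_on_compose_gen[OF _ g, unfolded o_def]) (use sub in \<open>auto intro!: holomorphic_intros\<close>)
    show "\<not> (h \<zeta> = 0 \<or> h \<zeta> = 1)" if "\<zeta> \<in> cball 0 1" for \<zeta>
      using om[OF sub[OF that]] by (simp add: h_def)
    show "norm ((z - u) / of_real d) \<le> 2/3"
      using z d by (simp add: norm_divide dist_norm norm_minus_commute field_simps)
  qed (use B in \<open>auto simp: h_def\<close>)
  moreover have "h ((z - u) / of_real d) = g z" using d by (simp add: h_def)
  ultimately show ?thesis by simp
qed

text \<open>Schottky's theorem bounds the whole family near a point once it is bounded at a nearby
  one. Connectedness of \<open>\<Omega>\<close> spreads the pointwise bound from \<open>w\<close>,
  and compactness of \<open>K\<close> makes it uniform; the constant depends on no single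
  \<open>g\<close>.\<close>

lemma schottky_family:
  assumes \<Omega>: "open \<Omega>" "connected \<Omega>" "w \<in> \<Omega>" and K: "compact K" "K \<subseteq> \<Omega>"
  obtains C where "C > 0"
    "\<And>g z. \<lbrakk>g holomorphic_on \<Omega>; \<And>z. z \<in> \<Omega> \<Longrightarrow> g z \<noteq> 0 \<and> g z \<noteq> 1; norm (g w) \<le> r; z \<in> K\<rbrakk> \<Longrightarrow> norm (g z) \<le> C"
proof -
  define Y where "Y = {g. g holomorphic_on \<Omega> \<and> (\<forall>z\<in>\<Omega>. g z \<noteq> 0 \<and> g z \<noteq> 1) \<and> norm (g w) \<le> r}"
  define P where "P z \<longleftrightarrow> (\<exists>B. \<forall>g\<in>Y. norm (g z) \<le> B)" for z
  have spread: "norm (g z) \<le> exp (pi * exp (pi * (2 + 2 * B + 24)))"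
    if "cball u d \<subseteq> \<Omega>" "d > 0" "\<forall>g\<in>Y. norm (g u) \<le> B" "dist u z \<le> 2/3 * d" "g \<in> Y" for u d B z g
    using that by (intro schottky_ball[where u = u and d = d]) (auto simp: Y_def intro: holomorphic_on_subset)
  have P: "P z" if "z \<in> \<Omega>" for z
  proof (rule connected_induction_simple[OF \<Omega>(2,3) that])
    show "P w" unfolding P_def Y_def by (rule exI[of _ r]) auto
    fix a assume "a \<in> \<Omega>"
    then obtain e where e: "e > 0" "cball a e \<subseteq> \<Omega>" using \<Omega>(1) open_contains_cball by metis
    \<comment> \<open>Points of the ball of radius \<open>e/4\<close> are less than
      \<open>e/2\<close> apart, which is 2/3 of the radius \<open>3/4 * e\<close> of a disc around
      \<open>x\<close> still inside the domain.\<close>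
    have "P y" if xy: "x \<in> ball a (e/4)" "y \<in> ball a (e/4)" and "P x" for x y
    proof -
      have "cball x (3/4*e) \<subseteq> cball a e" using xy by (simp add: cball_subset_cball_iff dist_commute)
      then have sub: "cball x (3/4*e) \<subseteq> \<Omega>" using e(2) by (rule subset_trans)
      have d: "dist x y \<le> 2/3 * (3/4 * e)"
        using dist_triangle_less_add[of x a "e/4" y "e/4"] xy by (simp add: dist_commute)
      obtain B where B: "\<forall>g\<in>Y. norm (g x) \<le> B" using \<open>P x\<close> unfolding P_def by blast
      have "3/4*e > 0" using e by simp
      from spread[OF sub this B d] show ?thesis unfolding P_def by blast
    qed
    then have step: "\<forall>x\<in>ball a (e/4). \<forall>y\<in>ball a (e/4). P x \<longrightarrow> P y" by blast
    have "ball a (e/4) \<subseteq> \<Omega>"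
    proof -
      have "ball a (e/4) \<subseteq> cball a e" using e by (intro subsetI) simp
      then show ?thesis using e(2) by (rule subset_trans)
    qed
    then have "openin (top_of_set \<Omega>) (ball a (e/4))" by (rule open_subset) simp
    moreover have "a \<in> ball a (e/4)" using e by simp
    ultimately show "\<exists>T. openin (top_of_set \<Omega>) T \<and> a \<in> T \<and> (\<forall>x\<in>T. \<forall>y\<in>T. P x \<longrightarrow> P y)"
      using step by (intro exI[of _ "ball a (e/4)"] conjI)
  qed
  have "\<exists>d B. d > 0 \<and> (\<forall>z\<in>ball u d. \<forall>g\<in>Y. norm (g z) \<le> B)" if "u \<in> K" for u
  proof -
    have "u \<in> \<Omega>" using that K by blast
    then obtain e where e: "e > 0" "cball u e \<subseteq> \<Omega>" using \<Omega>(1) open_contains_cball by metis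
    obtain B where "\<forall>g\<in>Y. norm (g u) \<le> B" using P[OF \<open>u \<in> \<Omega>\<close>] unfolding P_def by blast
    then have "\<forall>z\<in>ball u (2/3*e). \<forall>g\<in>Y. norm (g z) \<le> exp (pi * exp (pi * (2 + 2 * B + 24)))"
      using spread[OF e(2,1)] by (simp add: less_imp_le)
    moreover have "2/3*e > 0" using e by simp
    ultimately show ?thesis by blast
  qed
  then obtain d B where dB: "\<And>u. u \<in> K \<Longrightarrow> d u > 0" "\<And>u z g. u \<in> K \<Longrightarrow> z \<in> ball u (d u) \<Longrightarrow> g \<in> Y \<Longrightarrow> norm (g z) \<le> B u"
    by metis
  obtain D where D: "D \<subseteq> K" "finite D" "K \<subseteq> (\<Union>u\<in>D. ball u (d u))"
    by (rule compactE_image[OF K(1), of K "\<lambda>u. ball u (d u)"]) (use dB in force)+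
  define C where "C = 1 + (\<Sum>u\<in>D. \<bar>B u\<bar>)"
  show ?thesis
  proof
    show "C > 0" unfolding C_def by (simp add: add_pos_nonneg sum_nonneg)
    fix g z assume g: "g holomorphic_on \<Omega>" "\<And>z. z \<in> \<Omega> \<Longrightarrow> g z \<noteq> 0 \<and> g z \<noteq> 1" "norm (g w) \<le> r" "z \<in> K"
    then have "g \<in> Y" by (auto simp: Y_def)
    obtain u where u: "u \<in> D" "z \<in> ball u (d u)" using D g(4) by blast
    have "norm (g z) \<le> \<bar>B u\<bar>" using dB(2)[of u z g] u D \<open>g \<in> Y\<close> by fastforce
    also have "\<dots> \<le> (\<Sum>u\<in>D. \<bar>B u\<bar>)" using u D by (intro member_le_sum) auto
    finally show "norm (g z) \<le> C" by (simp add: C_def)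
  qed
qed

text \<open>Enlarging the removed disc to open discs of radius slightly above 1/8 gives connected
  sets that all contain 0 and exhaust the domain.\<close>

lemma connected_ball_minus_cball:
  "connected (ball (0::complex) 16 - cball 1 (1/8))"
proof -
  define \<A> where "\<A> = (\<lambda>r. ball (0::complex) 16 - ball 1 r) ` {1/8<..<1/4}"
  have eq: "ball (0::complex) 16 - cball 1 (1/8) = \<Union>\<A>"
  proof
    show "\<Union>\<A> \<subseteq> ball (0::complex) 16 - cball 1 (1/8)" unfolding \<A>_def by force
    show "ball (0::complex) 16 - cball 1 (1/8) \<subseteq> \<Union>\<A>"
    proof
      fix z :: complex assume z: "z \<in> ball 0 16 - cball 1 (1/8)"
      define r where "r = min (dist 1 z) (3/16)"
      have "r \<in> {1/8<..<1/4}" "z \<in> ball 0 16 - ball 1 r" using z by (auto simp: r_def)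
      then show "z \<in> \<Union>\<A>" unfolding \<A>_def by blast
    qed
  qed
  show ?thesis unfolding eq
  proof (rule connected_Union)
    show "connected s" if "s \<in> \<A>" for s
    proof -
      from that obtain r where "r \<in> {1/8<..<1/4}" "s = ball (0::complex) 16 - ball 1 r" unfolding \<A>_def by (rule imageE)
      then have r: "1/8 < r" "r < 1/4" "s = ball (0::complex) 16 - ball 1 r" by simp_all
      have "cball (1::complex) r \<subseteq> ball 0 16" using r by (simp add: cball_subset_ball_iff)
      then show ?thesis unfolding r by (intro connected_diff_ball) auto
    qed
    have "0 \<in> \<Inter>\<A>" by (auto simp: \<A>_def)
    then show "\<Inter>\<A> \<noteq> {}" by blast
  qed
qed

context transcendental_map begin

text \<open>The function \<open>(f (c * \<zeta>) - a) / (b - a)\<close> omits 0 and 1. The constant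
  is independent of the scale \<open>c\<close> and of the pair, so it serves at all radii at
  once.\<close>

lemma omitted_pair_bound:
  assumes \<Omega>: "open \<Omega>" "connected \<Omega>" "w \<in> \<Omega>" and K: "compact K" "K \<subseteq> \<Omega>"
  obtains C where "C > 0"
    "\<And>c a b \<zeta>. \<lbrakk>a \<noteq> b; \<And>\<zeta>. \<zeta> \<in> \<Omega> \<Longrightarrow> f (c * \<zeta>) \<noteq> a \<and> f (c * \<zeta>) \<noteq> b;
       norm (f (c * w) - a) \<le> r * norm (a - b); \<zeta> \<in> K\<rbrakk> \<Longrightarrow> norm (f (c * \<zeta>)) \<le> norm a + C * norm (a - b)"
proof -
  obtain C where C: "C > 0"
    "\<And>g z. \<lbrakk>g holomorphic_on \<Omega>; \<And>z. z \<in> \<Omega> \<Longrightarrow> g z \<noteq> 0 \<and> g z \<noteq> 1; norm (g w) \<le> r; z \<in> K\<rbrakk> \<Longrightarrow> norm (g z) \<le> C"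
    using schottky_family[OF \<Omega> K, of r] by metis
  show ?thesis
  proof
    fix c a b \<zeta>
    assume ab: "a \<noteq> b" and om: "\<And>\<zeta>. \<zeta> \<in> \<Omega> \<Longrightarrow> f (c * \<zeta>) \<noteq> a \<and> f (c * \<zeta>) \<noteq> b"
      and base: "norm (f (c * w) - a) \<le> r * norm (a - b)" and \<zeta>: "\<zeta> \<in> K"
    define g where "g = (\<lambda>\<zeta>. (f (c * \<zeta>) - a) / (b - a))"
    have "norm (g \<zeta>) \<le> C"
    proof (rule C(2)[OF _ _ _ \<zeta>])
      have "(\<lambda>\<zeta>. f (c * \<zeta>)) holomorphic_on \<Omega>"
        by (rule holomorphic_on_compose_gen[OF _ holo[of UNIV], unfolded o_def]) (auto intro!: holomorphic_intros)
      then show "g holomorphic_on \<Omega>" unfolding g_def using ab by (auto intro!: holomorphic_intros)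
      show "g z \<noteq> 0 \<and> g z \<noteq> 1" if "z \<in> \<Omega>" for z
        using om[OF that] ab by (auto simp: g_def field_simps)
      show "norm (g w) \<le> r" using base ab by (simp add: g_def norm_divide norm_minus_commute field_simps)
    qed
    then have "norm (f (c * \<zeta>) - a) \<le> C * norm (a - b)"
      using ab by (simp add: g_def norm_divide norm_minus_commute field_simps)
    then show "norm (f (c * \<zeta>)) \<le> norm a + C * norm (a - b)"
      using norm_triangle_sub[of "f (c * \<zeta>)" a] by linarith
  qed (rule C)
qed

text \<open>If the two values were omitted outside the small disc, then Schottky's theorem, applied in a
  domain that avoids the disc and contains a circle of radius at least \<open>5/4 * \<rho>\<close> (or a point where
  the maximum modulus is attained), would bound \<open>M (5/4 * \<rho>)\<close> by a constant multiple of \<open>M \<rho>\<close>.\<close>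

lemma separated_pair_hit:
  "\<exists>r1>0. \<forall>\<rho>\<ge>r1. \<forall>a b x. norm (a - b) = M \<rho> \<longrightarrow> norm a \<le> 9 * norm (a - b) \<longrightarrow>
     (\<exists>z. norm z \<le> 64 * \<rho> \<and> z \<notin> ball x (norm x / 8) \<and> (f z = a \<or> f z = b))"
proof -
  obtain C1 where C1: "C1 > 0" "\<And>c a b \<zeta>. \<lbrakk>a \<noteq> b; \<And>\<zeta>. \<zeta> \<in> ball 0 2 \<Longrightarrow> f (c * \<zeta>) \<noteq> a \<and> f (c * \<zeta>) \<noteq> b;
       norm (f (c * 0) - a) \<le> 10 * norm (a - b); \<zeta> \<in> cball 0 (5/4)\<rbrakk> \<Longrightarrow> norm (f (c * \<zeta>)) \<le> norm a + C1 * norm (a - b)"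
    using omitted_pair_bound[of "ball 0 2" 0 "cball 0 (5/4)" 10] by (auto simp: cball_subset_ball_iff)
  obtain C2 where C2: "C2 > 0" "\<And>c a b \<zeta>. \<lbrakk>a \<noteq> b; \<And>\<zeta>. \<zeta> \<in> ball 1 (1/2) \<Longrightarrow> f (c * \<zeta>) \<noteq> a \<and> f (c * \<zeta>) \<noteq> b;
       norm (f (c * 1) - a) \<le> 10 * norm (a - b); \<zeta> \<in> {5/4}\<rbrakk> \<Longrightarrow> norm (f (c * \<zeta>)) \<le> norm a + C2 * norm (a - b)"
    using omitted_pair_bound[of "ball 1 (1/2)" 1 "{5/4}" 10] by (auto simp: dist_norm)
  obtain C3 where C3: "C3 > 0" "\<And>c a b \<zeta>. \<lbrakk>a \<noteq> b; \<And>\<zeta>. \<zeta> \<in> ball 0 16 - cball 1 (1/8) \<Longrightarrow> f (c * \<zeta>) \<noteq> a \<and> f (c * \<zeta>) \<noteq> b;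
       norm (f (c * 0) - a) \<le> 10 * norm (a - b); \<zeta> \<in> sphere 0 8\<rbrakk> \<Longrightarrow> norm (f (c * \<zeta>)) \<le> norm a + C3 * norm (a - b)"
  proof -
    have "sphere (0::complex) 8 \<subseteq> ball 0 16 - cball 1 (1/8)"
    proof
      fix z :: complex assume "z \<in> sphere 0 8"
      then show "z \<in> ball 0 16 - cball 1 (1/8)"
        using norm_triangle_ineq[of 1 "z - 1"] by (auto simp: dist_norm norm_minus_commute)
    qed
    then show ?thesis
      using omitted_pair_bound[OF _ connected_ball_minus_cball, of 0 "sphere 0 8" 10] that by (auto simp: open_Diff)
  qed
  define C where "C = C1 + C2 + C3"
  obtain r1 where r1: "r1 > 0" "\<And>r. r \<ge> r1 \<Longrightarrow> (10 + C) * M r \<le> M (5/4 * r)"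
    using max_modulus_ratio[of "5/4" "10 + C"] by auto
  show ?thesis
  proof (intro exI[of _ r1] conjI r1 allI impI, rule ccontr)
    fix \<rho> a b x
    assume \<rho>: "r1 \<le> \<rho>" and q: "norm (a - b) = M \<rho>" and a9: "norm a \<le> 9 * norm (a - b)"
      and "\<not> (\<exists>z. norm z \<le> 64 * \<rho> \<and> z \<notin> ball x (norm x / 8) \<and> (f z = a \<or> f z = b))"
    then have om: "f z \<noteq> a \<and> f z \<noteq> b" if "norm z \<le> 64 * \<rho>" "z \<notin> ball x (norm x / 8)" for z
      using that by blast
    have \<rho>0: "\<rho> > 0" using \<rho> r1 by simp
    have Mp: "M \<rho> > 0" using max_modulus_pos[OF \<rho>0] .
    then have ab: "a \<noteq> b" using q by auto
    have base: "norm (f z - a) \<le> 10 * norm (a - b)" if "norm z \<le> \<rho>" for z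
      using norm_le_max_modulus[OF that] norm_triangle_ineq4[of "f z" a] a9 q by linarith
    have outside: "7/8 * norm x \<le> norm z \<and> norm z \<le> 9/8 * norm x" if "z \<in> ball x (norm x / 8)" for z
      using that norm_triangle_ineq2[of x z] norm_triangle_ineq2[of z x] by (auto simp: dist_norm norm_minus_commute)
    have "M (5/4 * \<rho>) \<le> norm a + C * norm (a - b)"
    proof -
      \<comment> \<open>The disc lies beyond radius \<open>2 * \<rho>\<close>, or inside radius
        \<open>\<rho> / 2\<close>, or has centre of modulus comparable with \<open>\<rho>\<close>.
        In the last case the scale is \<open>x\<close> itself, and
        \<open>16 * norm x < 64 * \<rho>\<close> explains the 64.\<close>
      consider "norm x \<ge> 4 * \<rho>" | "norm x \<le> \<rho> / 4" | "norm x < 4 * \<rho>" "norm x > \<rho> / 4" by linarith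
      then show ?thesis
      proof cases
        case 1
        obtain z where z: "norm z = 5/4 * \<rho>" "norm (f z) = M (5/4 * \<rho>)"
          using max_modulus_attained(1)[of "5/4 * \<rho>"] \<rho>0 by auto
        have "norm (f (of_real \<rho> * (z / of_real \<rho>))) \<le> norm a + C1 * norm (a - b)"
        proof (rule C1(2)[OF ab])
          fix \<zeta> :: complex assume "\<zeta> \<in> ball 0 2"
          then have "norm (of_real \<rho> * \<zeta>) < 2 * \<rho>" using \<rho>0 by (simp add: norm_mult)
          then show "f (of_real \<rho> * \<zeta>) \<noteq> a \<and> f (of_real \<rho> * \<zeta>) \<noteq> b"
            using outside[of "of_real \<rho> * \<zeta>"] 1 \<rho>0 by (intro om) auto
        qed (use base[of 0] \<rho>0 z in \<open>auto simp: norm_divide\<close>)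
        then have "M (5/4 * \<rho>) \<le> norm a + C1 * norm (a - b)" using z \<rho>0 by simp
        also have "\<dots> \<le> norm a + C * norm (a - b)" using C1 C2 C3 by (auto simp: C_def intro!: mult_right_mono)
        finally show ?thesis .
      next
        case 2
        obtain z where z: "norm z = 5/4 * \<rho>" "norm (f z) = M (5/4 * \<rho>)"
          using max_modulus_attained(1)[of "5/4 * \<rho>"] \<rho>0 by auto
        define c where "c = z / (5/4)"
        have c: "norm c = \<rho>" "c * (5/4) = z" using z by (auto simp: c_def norm_divide)
        have "norm (f (c * (5/4))) \<le> norm a + C2 * norm (a - b)"
        proof (rule C2(2)[OF ab])
          fix \<zeta> :: complex assume \<zeta>: "\<zeta> \<in> ball 1 (1/2)"
          have "norm \<zeta> \<ge> 1/2" "norm \<zeta> \<le> 3/2"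
            using \<zeta> norm_triangle_ineq2[of 1 \<zeta>] norm_triangle_ineq2[of \<zeta> 1] by (auto simp: dist_norm norm_minus_commute)
          then have "norm (c * \<zeta>) \<ge> \<rho> * (1/2)" "norm (c * \<zeta>) \<le> \<rho> * (3/2)"
            unfolding norm_mult c using \<rho>0 by (intro mult_left_mono; simp)+
          then show "f (c * \<zeta>) \<noteq> a \<and> f (c * \<zeta>) \<noteq> b"
            using outside[of "c * \<zeta>"] 2 \<rho>0 by (intro om) auto
        qed (use base[of c] c in auto)
        then have "M (5/4 * \<rho>) \<le> norm a + C2 * norm (a - b)" using z c by simp
        also have "\<dots> \<le> norm a + C * norm (a - b)" using C1 C2 C3 by (auto simp: C_def intro!: mult_right_mono)
        finally show ?thesis .
      next
        case 3
        then have x0: "norm x > 0" "x \<noteq> 0" using \<rho>0 by auto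
        obtain z where z: "norm z = 8 * norm x" "norm (f z) = M (8 * norm x)"
          using max_modulus_attained(1)[of "8 * norm x"] by auto
        have "norm (f (x * (z / x))) \<le> norm a + C3 * norm (a - b)"
        proof (rule C3(2)[OF ab])
          fix \<zeta> :: complex assume \<zeta>: "\<zeta> \<in> ball 0 16 - cball 1 (1/8)"
          have "norm (x * \<zeta>) \<le> norm x * 16" unfolding norm_mult using \<zeta> by (intro mult_left_mono) auto
          then have 1: "norm (x * \<zeta>) \<le> 64 * \<rho>" using 3 by linarith
          have "norm x * (1/8) \<le> norm x * norm (1 - \<zeta>)"
            using \<zeta> by (intro mult_left_mono) (auto simp: dist_norm)
          also have "\<dots> = dist x (x * \<zeta>)" by (simp add: dist_norm norm_mult[symmetric] algebra_simps)
          finally show "f (x * \<zeta>) \<noteq> a \<and> f (x * \<zeta>) \<noteq> b" using 1 by (intro om) auto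
        qed (use base[of 0] \<rho>0 z x0 in \<open>auto simp: norm_divide\<close>)
        then have "M (8 * norm x) \<le> norm a + C3 * norm (a - b)" using z x0 by simp
        moreover have "M (5/4 * \<rho>) \<le> M (8 * norm x)" using 3 \<rho>0 by (intro max_modulus_mono) auto
        moreover have "C3 * norm (a - b) \<le> C * norm (a - b)" using C1 C2 C3 by (auto simp: C_def intro!: mult_right_mono)
        ultimately show ?thesis by linarith
      qed
    qed
    also have "\<dots> \<le> (9 + C) * M \<rho>" using a9 q by (simp add: algebra_simps)
    also have "\<dots> < (10 + C) * M \<rho>" using Mp by (intro mult_strict_right_mono) auto
    also have "\<dots> \<le> M (5/4 * \<rho>)" by (rule r1(2)[OF \<rho>])
    finally show False by simp
  qed
qed

text \<open>A low point is a base point with a value of size at most 1, so Schottky's theorem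
  applies to pairs much smaller than \<open>M (norm p)\<close>. Such pairs let the image reach back
  to smaller annuli.\<close>

lemma separated_pair_hit_near_low_point:
  "\<exists>C>0. \<forall>p a b. norm (f p) \<le> 1 \<longrightarrow> 1 \<le> norm (a - b) \<longrightarrow> norm a \<le> 9 * norm (a - b) \<longrightarrow>
     C * norm (a - b) < M (norm p) \<longrightarrow>
     (\<exists>z. norm p / 2 < norm z \<and> norm z < 2 * norm p \<and> (f z = a \<or> f z = b))"
proof -
  define \<Omega> where "\<Omega> = {\<zeta>::complex. 1/2 < norm \<zeta> \<and> norm \<zeta> < 2}"
  have con: "connected \<Omega>" using connected_annulus[of "1/2" "0::complex" 2] by (simp add: \<Omega>_def)
  have op: "open \<Omega>" unfolding \<Omega>_def by (auto intro!: open_Collect_conj open_Collect_less continuous_intros)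
  have w1: "1 \<in> \<Omega>" and sub: "sphere 0 1 \<subseteq> \<Omega>" by (auto simp: \<Omega>_def)
  obtain C where C: "C > 0" "\<And>c a b \<zeta>. \<lbrakk>a \<noteq> b; \<And>\<zeta>. \<zeta> \<in> \<Omega> \<Longrightarrow> f (c * \<zeta>) \<noteq> a \<and> f (c * \<zeta>) \<noteq> b;
       norm (f (c * 1) - a) \<le> 10 * norm (a - b); \<zeta> \<in> sphere 0 1\<rbrakk> \<Longrightarrow> norm (f (c * \<zeta>)) \<le> norm a + C * norm (a - b)"
    using omitted_pair_bound[OF op con w1 compact_sphere sub, of 10] by blast
  show ?thesis
  proof (intro exI[of _ "9 + C"] conjI allI impI, use C in simp, rule ccontr)
    fix p a b
    assume p: "norm (f p) \<le> 1" and ab: "1 \<le> norm (a - b)" and a9: "norm a \<le> 9 * norm (a - b)"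
      and lt: "(9 + C) * norm (a - b) < M (norm p)"
      and om: "\<not> (\<exists>z. norm p / 2 < norm z \<and> norm z < 2 * norm p \<and> (f z = a \<or> f z = b))"
    have p0: "p \<noteq> 0"
    proof
      assume "p = 0"
      then have "M (norm p) \<le> 1" using max_modulus_attained(1)[of 0] p by auto
      moreover have "1 \<le> (9 + C) * norm (a - b)" using mult_mono[of 1 "9 + C" 1 "norm (a - b)"] C ab by simp
      ultimately show False using lt by simp
    qed
    obtain z where z: "norm z = norm p" "norm (f z) = M (norm p)"
      using max_modulus_attained(1)[of "norm p"] by auto
    have "norm (f (p * (z / p))) \<le> norm a + C * norm (a - b)"
    proof (rule C(2))
      show "a \<noteq> b" using ab by auto
      fix \<zeta> assume \<zeta>: "\<zeta> \<in> \<Omega>"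
      have "norm p * (1/2) < norm (p * \<zeta>)" "norm (p * \<zeta>) < norm p * 2"
        unfolding norm_mult using \<zeta> p0 by (intro mult_strict_left_mono; simp add: \<Omega>_def)+
      then show "f (p * \<zeta>) \<noteq> a \<and> f (p * \<zeta>) \<noteq> b" using om by (metis mult.commute times_divide_eq_right mult.right_neutral)
    next
      show "norm (f (p * 1) - a) \<le> 10 * norm (a - b)"
        using norm_triangle_ineq4[of "f p" a] p ab a9 by simp
      show "z / p \<in> sphere 0 1" using z p0 by (simp add: norm_divide)
    qed
    then have "M (norm p) \<le> norm a + C * norm (a - b)" using z p0 by simp
    also have "\<dots> \<le> (9 + C) * norm (a - b)" using a9 by (simp add: algebra_simps)
    finally show False using lt by simp
  qed
qed

end

subsection \<open>Orbits with prescribed annular itineraries\<close>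

text \<open>Any omitted \<open>x\<close> forces the other omitted points into the disc about it:
  outside that disc \<open>norm x \<le> 8 * norm (x - b)\<close>, which makes the pair
  separated.\<close>

lemma separated_cover:
  fixes A S :: "complex set"
  assumes "\<And>a b. \<lbrakk>a \<in> A; b \<in> A; norm a \<le> 9 * norm (a - b)\<rbrakk> \<Longrightarrow> a \<in> S \<or> b \<in> S"
  shows "\<exists>x. A - ball x (norm x / 8) \<subseteq> S"
proof (cases "A \<subseteq> S")
  case True
  then show ?thesis by blast
next
  case False
  then obtain x where x: "x \<in> A" "x \<notin> S" by blast
  have "b \<in> S" if b: "b \<in> A" "b \<notin> ball x (norm x / 8)" for b
  proof -
    have "norm x / 8 \<le> norm (x - b)" using b by (simp add: dist_norm)
    then have "norm x \<le> 9 * norm (x - b)" using norm_ge_zero[of "x - b"] by linarith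
    then show ?thesis using assms[OF x(1) b(1)] x(2) by blast
  qed
  then show ?thesis by blast
qed

context transcendental_map begin

abbreviation "level v j \<equiv> (M ^^ j) v"

text \<open>Consecutive annuli overlap: the preimages found below have modulus up to
  \<open>64 * (2 * level v (j + 2))\<close>, hence 128. The centre \<open>x\<close> is left free
  because the covering lemma does not control which disc is missed.\<close>

definition cut_annulus :: "real \<Rightarrow> nat \<Rightarrow> complex \<Rightarrow> complex set" where
  "cut_annulus v j x = {z. level v j \<le> norm z \<and> norm z \<le> 128 * level v (j + 2)} - ball x (norm x / 8)"

text \<open>The ratio 8 ensures that a disc \<open>ball x (norm x / 8)\<close> meets at most one of
  the annuli from half to twice the modulus of the two low points. The outer factors 2 and 64 keep
  both these annuli inside the large one.\<close>

definition low_pair :: "real \<Rightarrow> nat \<Rightarrow> bool" where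
  "low_pair v j \<longleftrightarrow> (\<exists>p p'. norm (f p) \<le> 1 \<and> norm (f p') \<le> 1 \<and>
     2 * level v j \<le> norm p \<and> 8 * norm p \<le> norm p' \<and> norm p' \<le> 64 * level v (j + 2))"

definition itinerary_scale :: "real \<Rightarrow> bool" where
  "itinerary_scale v \<longleftrightarrow> v > 0 \<and> (\<forall>r\<ge>v. 200 * r \<le> M r) \<and>
     (\<forall>j x. \<exists>x'. cut_annulus v (Suc j) x' \<subseteq> f ` cut_annulus v j x) \<and>
     (\<forall>j x. low_pair v (Suc j) \<longrightarrow> (\<exists>x'. cut_annulus v j x' \<subseteq> f ` cut_annulus v (Suc j) x))"

lemma level_ge:
  assumes "v > 0" "\<forall>r\<ge>v. 200 * r \<le> M r"
  shows "v \<le> level v j" "200 * level v j \<le> level v (Suc j)"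
proof -
  have 1: "v \<le> level v j" for j
  proof (induction j)
    case (Suc j)
    then have "200 * level v j \<le> M (level v j)" using assms by blast
    with Suc assms(1) show ?case by simp
  qed auto
  then show "v \<le> level v j" "200 * level v j \<le> level v (Suc j)" using assms by auto
qed

lemma level_mono:
  assumes "v > 0" "\<forall>r\<ge>v. 200 * r \<le> M r" "i \<le> j"
  shows "level v i \<le> level v j"
proof (rule lift_Suc_mono_le[of "\<lambda>j. level v j", OF _ assms(3)])
  show "level v n \<le> level v (Suc n)" for n
    using level_ge[OF assms(1,2), of n] assms(1) by linarith
qed

text \<open>Going up, a separated pair in the next annulus is \<open>M \<rho>\<close> apart for some
  \<open>\<rho>\<close> between \<open>level v j / 2\<close> and \<open>2 * level v (j + 2)\<close>,
  so \<open>separated_pair_hit\<close> supplies a preimage. Going down, the low points take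
  over.\<close>

lemma itinerary_scale_exists: "\<exists>v0. \<forall>v\<ge>v0. itinerary_scale v"
proof -
  obtain r1 where r1: "r1 > 0" "\<And>\<rho> a b x. \<lbrakk>\<rho> \<ge> r1; norm (a - b) = M \<rho>; norm a \<le> 9 * norm (a - b)\<rbrakk> \<Longrightarrow>
     \<exists>z. norm z \<le> 64 * \<rho> \<and> z \<notin> ball x (norm x / 8) \<and> (f z = a \<or> f z = b)"
    using separated_pair_hit by blast
  obtain C where C: "C > 0" "\<And>p a b. \<lbrakk>norm (f p) \<le> 1; 1 \<le> norm (a - b); norm a \<le> 9 * norm (a - b);
     C * norm (a - b) < M (norm p)\<rbrakk> \<Longrightarrow> \<exists>z. norm p / 2 < norm z \<and> norm z < 2 * norm p \<and> (f z = a \<or> f z = b)"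
    using separated_pair_hit_near_low_point by blast
  define K where "K = 300 + 256 * C"
  have K: "K > 256" "K > 9" "K > 256 * C" using C by (auto simp: K_def)
  obtain r2 where r2: "r2 > 0" "\<And>r. r \<ge> r2 \<Longrightarrow> K * M r \<le> M (2 * r)"
    using max_modulus_ratio[of 2 K] by auto
  obtain r3 where r3: "\<And>r. r \<ge> r3 \<Longrightarrow> r ^ 2 \<le> M r" using max_modulus_power by blast
  define v0 where "v0 = Max {2 * r1, 2 * r2, r3, 200}"
  have v0: "2 * r1 \<le> v0" "2 * r2 \<le> v0" "r3 \<le> v0" "200 \<le> v0" unfolding v0_def by auto
  have "itinerary_scale v" if v: "v \<ge> v0" for v
  proof -
    have v_pos: "v > 0" and v200: "v \<ge> 200" using v v0 by auto
    have grow: "\<forall>r\<ge>v. 200 * r \<le> M r"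
    proof (intro allI impI)
      fix r assume r: "v \<le> r"
      have "200 * r \<le> r * r" using r v200 by (intro mult_right_mono) auto
      also have "\<dots> \<le> M r" using r3[of r] r v v0 by (simp add: power2_eq_square)
      finally show "200 * r \<le> M r" .
    qed
    note lv = level_ge[OF v_pos grow]
    have Kr: "K * M r \<le> M (2 * r)" if "r \<ge> v / 2" for r
      using r2(2)[of r] that v v0 by linarith
    have lpos: "level v j > 0" for j using lv(1)[of j] v_pos by linarith
    have up: "\<exists>x'. cut_annulus v (Suc j) x' \<subseteq> f ` cut_annulus v j x" for j x
      unfolding cut_annulus_def[of v "Suc j"]
    proof (rule separated_cover)
      fix a b :: complex
      assume a: "a \<in> {z. level v (Suc j) \<le> norm z \<and> norm z \<le> 128 * level v (Suc j + 2)}"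
        and b: "b \<in> {z. level v (Suc j) \<le> norm z \<and> norm z \<le> 128 * level v (Suc j + 2)}"
        and a9: "norm a \<le> 9 * norm (a - b)"
      have h1: "9 * M (level v j / 2) \<le> level v (Suc j)"
      proof -
        have "9 * M (level v j / 2) \<le> K * M (level v j / 2)"
          using K max_modulus_nonneg[of "level v j / 2"] lpos[of j] by (intro mult_right_mono) auto
        also have "\<dots> \<le> M (level v j)" using Kr[of "level v j / 2"] lv(1)[of j] by simp
        finally show ?thesis by simp
      qed
      then have q1: "M (level v j / 2) \<le> norm (a - b)" using a a9 by auto
      have "M 0 \<le> M (level v j / 2)" using lpos[of j] by (intro max_modulus_mono) auto
      then have "M 0 \<le> norm (a - b)" using q1 by linarith
      then obtain \<rho> where \<rho>: "\<rho> \<ge> 0" "M \<rho> = norm (a - b)" by (rule max_modulus_surj)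
      have "norm (a - b) \<le> 256 * M (level v (j + 2))"
        using a b norm_triangle_ineq4[of a b] by simp
      also have "\<dots> \<le> K * M (level v (j + 2))"
        using K max_modulus_nonneg[of "level v (j + 2)"] lpos[of "j+2"] by (intro mult_right_mono) auto
      also have "\<dots> \<le> M (2 * level v (j + 2))" using lv(1)[of "j+2"] v_pos by (intro Kr) linarith
      finally have q2: "norm (a - b) \<le> M (2 * level v (j + 2))" .
      have \<rho>2: "\<rho> \<le> 2 * level v (j + 2)"
        by (rule max_modulus_le_cancel) (use \<rho> q2 lpos[of "j+2"] in auto)
      have "level v j / 2 \<le> \<rho>"
        by (rule max_modulus_le_cancel) (use \<rho> q1 lpos[of j] in auto)
      then have "\<rho> \<ge> r1" using lv(1)[of j] v v0 by linarith
      then obtain z where z: "norm z \<le> 64 * \<rho>" "z \<notin> ball x (norm x / 8)" "f z = a \<or> f z = b"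
        using r1(2)[OF _ \<rho>(2)[symmetric] a9, where x = x] by blast
      \<comment> \<open>The inner bound is automatic, since points of smaller modulus have images
        below \<open>level v (Suc j)\<close>.\<close>
      have "level v j \<le> norm z"
      proof (rule ccontr)
        assume "\<not> ?thesis"
        then have "norm (f z) < level v (Suc j)" using norm_less_max_modulus[of z "level v j"] by simp
        then show False using z a b by auto
      qed
      then have "z \<in> cut_annulus v j x" using z \<rho>2 by (auto simp: cut_annulus_def)
      then show "a \<in> f ` cut_annulus v j x \<or> b \<in> f ` cut_annulus v j x" using z(3) by auto
    qed
    have down: "\<exists>x'. cut_annulus v j x' \<subseteq> f ` cut_annulus v (Suc j) x" if low: "low_pair v (Suc j)" for j x
      unfolding cut_annulus_def[of v j]
    proof (rule separated_cover)
      fix a b :: complex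
      assume a: "a \<in> {z. level v j \<le> norm z \<and> norm z \<le> 128 * level v (j + 2)}"
        and b: "b \<in> {z. level v j \<le> norm z \<and> norm z \<le> 128 * level v (j + 2)}"
        and a9: "norm a \<le> 9 * norm (a - b)"
      obtain p p' where p: "norm (f p) \<le> 1" "norm (f p') \<le> 1" "2 * level v (Suc j) \<le> norm p"
        "8 * norm p \<le> norm p'" "norm p' \<le> 64 * level v (Suc j + 2)"
        using low unfolding low_pair_def by blast
      have q1: "1 \<le> norm (a - b)" using a a9 lv(1)[of j] v200 by auto
      \<comment> \<open>Here \<open>level v (j + 2)\<close> is \<open>M\<close> at
        \<open>level v (Suc j)\<close>, and doubling that radius beats the constant; the low points
        have at least the doubled modulus.\<close>
      have "C * norm (a - b) \<le> C * (256 * level v (j + 2))"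
        using C a b norm_triangle_ineq4[of a b] by (intro mult_left_mono) auto
      also have "\<dots> < K * level v (j + 2)" using K lpos[of "j+2"] by simp
      also have "\<dots> = K * M (level v (Suc j))" by simp
      also have "\<dots> \<le> M (2 * level v (Suc j))" using lv(1)[of "Suc j"] v_pos by (intro Kr) linarith
      finally have CM: "C * norm (a - b) < M (norm u)" if "2 * level v (Suc j) \<le> norm u" for u :: complex
        using max_modulus_mono[OF _ that] lpos[of "Suc j"] by simp
      have hit: "a \<in> f ` cut_annulus v (Suc j) x \<or> b \<in> f ` cut_annulus v (Suc j) x"
        if u: "norm (f u) \<le> 1" "2 * level v (Suc j) \<le> norm u" "norm u \<le> 64 * level v (Suc j + 2)"
          and avoid: "\<And>z. norm u / 2 < norm z \<Longrightarrow> norm z < 2 * norm u \<Longrightarrow> z \<notin> ball x (norm x / 8)" for u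
      proof -
        obtain z where z: "norm u / 2 < norm z" "norm z < 2 * norm u" "f z = a \<or> f z = b"
          using C(2)[OF u(1) q1 a9 CM[OF u(2)]] by blast
        then have "z \<in> cut_annulus v (Suc j) x" using avoid u by (auto simp: cut_annulus_def)
        then show ?thesis using z(3) by auto
      qed
      have pp: "2 * level v (Suc j) \<le> norm p'" "norm p \<le> 64 * level v (Suc j + 2)"
        using p lpos[of "Suc j"] by linarith+
      show "a \<in> f ` cut_annulus v (Suc j) x \<or> b \<in> f ` cut_annulus v (Suc j) x"
      \<comment> \<open>The low point \<open>p\<close> is used if its annulus avoids the removed
        disc, and \<open>p'\<close> otherwise.\<close>
      proof (cases "\<exists>z. norm p / 2 < norm z \<and> norm z < 2 * norm p \<and> z \<in> ball x (norm x / 8)")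
        case False
        then show ?thesis using hit[OF p(1,3) pp(2)] by blast
      next
        case True
        then obtain z where z: "norm z < 2 * norm p" "z \<in> ball x (norm x / 8)" by blast
        have "y \<notin> ball x (norm x / 8)" if "norm p' / 2 < norm y" for y
        proof
          assume y: "y \<in> ball x (norm x / 8)"
          have "norm y \<le> 9/8 * norm x" "7/8 * norm x \<le> norm z"
            using y z norm_triangle_ineq2[of x z] norm_triangle_ineq2[of y x]
            by (auto simp: dist_norm norm_minus_commute)
          then show False using that z p(4) norm_ge_zero[of x] by linarith
        qed
        then show ?thesis using hit[OF p(2) pp(1) p(5)] by blast
      qed
    qed
    show ?thesis unfolding itinerary_scale_def using v_pos grow up down by blast
  qed
  then show ?thesis by blast
qed

lemma compact_cut_annulus: "compact (cut_annulus v j x)"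
proof -
  have "closed {z::complex. level v j \<le> norm z \<and> norm z \<le> 128 * level v (j + 2)}"
    by (auto intro!: closed_Collect_conj closed_Collect_le continuous_intros)
  moreover have "bounded {z::complex. level v j \<le> norm z \<and> norm z \<le> 128 * level v (j + 2)}"
    unfolding bounded_iff by auto
  ultimately show ?thesis unfolding cut_annulus_def
    by (auto simp: compact_eq_bounded_closed intro: bounded_subset closed_Diff)
qed

lemma cut_annulus_nonempty:
  assumes "v > 0" "\<forall>r\<ge>v. 200 * r \<le> M r"
  shows "cut_annulus v j x \<noteq> {}"
proof -
  define w where "w = complex_of_real (level v j)"
  note lv = level_ge[OF assms]
  have "level v j > 0" using lv(1)[of j] assms by linarith
  then have w: "norm w = level v j" "norm (-w) = level v j" "level v j > 0" by (auto simp: w_def)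
  have "200 * level v j \<le> level v (Suc j)" "200 * level v (Suc j) \<le> level v (j + 2)"
    using lv(2)[of j] lv(2)[of "Suc j"] by (simp_all only: add_2_eq_Suc' )
  then have "level v j \<le> 128 * level v (j + 2)" using w by linarith
  \<comment> \<open>Antipodal points cannot both lie in the disc: adding their distances to
    \<open>x\<close> would give \<open>2 * norm x < norm x / 4\<close>.\<close>
  moreover have "w \<notin> ball x (norm x / 8) \<or> - w \<notin> ball x (norm x / 8)"
  proof (rule ccontr)
    assume "\<not> ?thesis"
    then have d: "norm (x - w) < norm x / 8" "norm (x - (-w)) < norm x / 8" by (auto simp: dist_norm)
    have "2 * norm x = norm ((x - w) + (x - (-w)))" by (simp add: norm_mult flip: mult_2)
    also have "\<dots> \<le> norm (x - w) + norm (x - (-w))" by (rule norm_triangle_ineq)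
    finally show False using d norm_ge_zero[of x] by linarith
  qed
  ultimately have "w \<in> cut_annulus v j x \<or> - w \<in> cut_annulus v j x" using w by (simp add: cut_annulus_def)
  then show ?thesis by blast
qed

text \<open>Every occurrence of a low pair is an opportunity to stay two levels behind the maximal speed;
  the opportunity is taken only once the iterates of \<open>mt\<close> lag far enough behind those of \<open>M\<close>.\<close>

lemma slow_point_in_V:
  assumes V: "V_radius f R" and "R \<le> v" and v: "itinerary_scale v"
    and low: "\<And>J. \<exists>j\<ge>J. low_pair v j"
    and lag: "\<And>l. \<exists>N. \<forall>n\<ge>N. (mt ^^ n) R \<le> level v (n - l)"
  shows "V_set f \<noteq> fast_escaping_set f"
proof -
  have v_pos: "v > 0" and grow: "\<forall>r\<ge>v. 200 * r \<le> M r" using v by (auto simp: itinerary_scale_def)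
  obtain N where N: "\<And>l n. n \<ge> N l \<Longrightarrow> (mt ^^ n) R \<le> level v (n - l)" using lag by metis
  \<comment> \<open>Here \<open>s\<close> counts the backward steps so far and
    \<open>n - 2 * s\<close> is the current annulus. The last condition guarantees the lag
    \<open>2 * (s + 1)\<close> from time \<open>Suc n\<close> on, so a step back keeps the orbit
    above the iterates of \<open>mt\<close>; the middle one keeps the index positive.\<close>
  define slip where "slip n s \<longleftrightarrow> low_pair v (n - 2 * s) \<and> 2 * s + 1 \<le> n \<and> N (2 * s + 2) \<le> Suc n" for n s
  define \<sigma> where "\<sigma> = rec_nat 0 (\<lambda>n s. if slip n s then Suc s else s)"
  have \<sigma>0: "\<sigma> 0 = 0" and \<sigma>Suc: "\<sigma> (Suc n) = (if slip n (\<sigma> n) then Suc (\<sigma> n) else \<sigma> n)" for n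
    by (simp_all add: \<sigma>_def)
  \<comment> \<open>A backward step lowers the index by one where a forward step would raise it by
    one, so it costs two.\<close>
  define j where "j n = n - 2 * \<sigma> n" for n
  have inv: "2 * \<sigma> n \<le> n \<and> (mt ^^ n) R \<le> level v (j n)" for n
  proof (induction n)
    case 0
    show ?case using \<open>R \<le> v\<close> by (simp add: \<sigma>0 j_def)
  next
    case (Suc n)
    show ?case
    proof (cases "slip n (\<sigma> n)")
      case True
      then show ?thesis using N[of "2 * \<sigma> n + 2" "Suc n"] by (auto simp: \<sigma>Suc slip_def j_def)
    next
      case False
      have "mt ((mt ^^ n) R) \<le> M ((mt ^^ n) R)"
        using V by (intro max_min_le_max_modulus max_min_modulus_funpow_nonneg) (simp add: V_radius_def)
      also have "\<dots> \<le> M (level v (j n))"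
        using Suc V by (intro max_modulus_mono max_min_modulus_funpow_nonneg) (auto simp: V_radius_def)
      also have "\<dots> = level v (j (Suc n))" using False Suc by (simp add: j_def \<sigma>Suc Suc_diff_le)
      finally show ?thesis using False Suc by (simp add: \<sigma>Suc)
    qed
  qed
  \<comment> \<open>For fixed \<open>s\<close> the waiting time is finite and low pairs recur, so
    another backward step always happens.\<close>
  have unb: "\<exists>n. \<sigma> n = s" for s
  proof (induction s)
    case 0
    show ?case using \<sigma>0 by blast
  next
    case (Suc s)
    then obtain n0 where n0: "\<sigma> n0 = s" by blast
    show ?case
    proof (rule ccontr)
      assume no: "\<not> ?thesis"
      have const: "\<sigma> (n0 + k) = s" for k
      proof (induction k)
        case (Suc k)
        then show ?case using no \<sigma>Suc[of "n0 + k"] by (auto split: if_splits)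
      qed (use n0 in simp)
      obtain i where i: "i \<ge> n0 + N (2 * s + 2) + 1" "low_pair v i" using low by blast
      have "\<sigma> (i + 2 * s) = s" using const[of "i + 2 * s - n0"] i by simp
      moreover have "slip (i + 2 * s) s" using i by (simp add: slip_def)
      ultimately have "\<sigma> (Suc (i + 2 * s)) = Suc s" by (simp add: \<sigma>Suc)
      then show False using no by blast
    qed
  qed
  have step: "\<exists>x'. cut_annulus v (j (Suc n)) x' \<subseteq> f ` cut_annulus v (j n) x" for n x
  proof (cases "slip n (\<sigma> n)")
    case True
    then have "j n = Suc (j (Suc n))" "low_pair v (j n)" by (auto simp: j_def \<sigma>Suc slip_def)
    then show ?thesis using v unfolding itinerary_scale_def by metis
  next
    case False
    then have "j (Suc n) = Suc (j n)" using inv[of n] by (simp add: j_def \<sigma>Suc Suc_diff_le)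
    then show ?thesis using v unfolding itinerary_scale_def by metis
  qed
  obtain x where x: "\<And>n. cut_annulus v (j (Suc n)) (x (Suc n)) \<subseteq> f ` cut_annulus v (j n) (x n)"
    using dependent_nat_choice[of "\<lambda>n x. True" "\<lambda>n x x'. cut_annulus v (j (Suc n)) x' \<subseteq> f ` cut_annulus v (j n) x"]
      step by auto
  obtain z where z: "\<And>n. (f ^^ n) z \<in> cut_annulus v (j n) (x n)"
    using compact_orbit_exists[of "\<lambda>n. cut_annulus v (j n) (x n)" f] compact_cut_annulus
      cut_annulus_nonempty[OF v_pos grow] cont x by blast
  then have zl: "level v (j n) \<le> norm ((f ^^ n) z)" and zu: "norm ((f ^^ n) z) \<le> 128 * level v (j n + 2)" for n
    using z[of n] by (auto simp: cut_annulus_def)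
  have "z \<in> V_level f R" unfolding V_level_def using inv zl by (blast intro: order_trans)
  then have "z \<in> V_set f" unfolding V_set_eq[OF V] by (auto intro!: exI[of _ 0])
  moreover have "z \<notin> fast_escaping_set f"
  proof
    assume "z \<in> fast_escaping_set f"
    then obtain l where l: "\<And>n. n \<ge> 1 \<Longrightarrow> norm ((f ^^ n) ((f ^^ l) z)) \<ge> level v n"
      unfolding fast_escaping_set_eq[OF fast_escaping_radiusI_V[OF V_radius_mono[OF V \<open>R \<le> v\<close>]]]
      by (auto simp: fast_escaping_level_def)
    \<comment> \<open>Now \<open>j n + 2 = n - 2 * l - 6\<close> is at most
      \<open>n - l - 2\<close>, and one more level outweighs the factor 128.\<close>
    obtain n where n: "\<sigma> n = l + 4" using unb by blast
    have big: "2 * l + 8 \<le> n" using inv[of n] n by simp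
    have "(f ^^ (n - l)) ((f ^^ l) z) = (f ^^ n) z"
      using funpow_add[of "n - l" l f] big by simp
    then have "level v (n - l) \<le> norm ((f ^^ n) z)"
      using l[of "n - l"] big by simp
    also have "\<dots> \<le> 128 * level v (j n + 2)" using zu[of n] big by simp
    also have "\<dots> \<le> 128 * level v (n - l - 2)"
      using level_mono[OF v_pos grow, of "j n + 2" "n - l - 2"] big n by (simp add: j_def)
    also have "\<dots> < 200 * level v (n - l - 2)" using level_ge(1)[OF v_pos grow, of "n - l - 2"] v_pos by linarith
    also have "\<dots> \<le> level v (Suc (n - l - 2))" by (rule level_ge(2)[OF v_pos grow])
    also have "\<dots> \<le> level v (n - l)" using big by (intro level_mono[OF v_pos grow]) simp
    finally show False by simp
  qed
  ultimately show ?thesis by blast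
qed

end

subsection \<open>Harnack's inequality\<close>

text \<open>A Cayley transform of the right half-plane sending \<open>G u\<close> to 0 turns
  \<open>G\<close> into a self-map of the unit disc fixing 0. Schwarz's lemma, squared out, bounds
  the difference of the real parts by \<open>s\<close> times their sum.\<close>

lemma harnack_ball:
  assumes G: "G holomorphic_on ball u d" and pos: "\<And>z. z \<in> ball u d \<Longrightarrow> Re (G z) > 0"
    and z: "dist u z < d"
  shows "(d - dist u z) * Re (G z) \<le> (d + dist u z) * Re (G u)"
    and "(d - dist u z) * Re (G u) \<le> (d + dist u z) * Re (G z)"
proof -
  have d: "d > 0" using z zero_le_dist[of u z] by linarith
  define s where "s = dist u z / d"
  have s: "0 \<le> s" "s < 1" "dist u z = s * d" using z d by (auto simp: s_def)
  define W where "W = (\<lambda>\<zeta>. (G (u + of_real d * \<zeta>) - G u) / (G (u + of_real d * \<zeta>) + cnj (G u)))"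
  have sub: "u + of_real d * \<zeta> \<in> ball u d" if "norm \<zeta> < 1" for \<zeta>
    using that d by (simp add: dist_norm norm_mult)
  have Gu: "Re (G u) > 0" using pos d by simp
  have ne: "G (u + of_real d * \<zeta>) + cnj (G u) \<noteq> 0" if "norm \<zeta> < 1" for \<zeta>
  proof
    assume "G (u + of_real d * \<zeta>) + cnj (G u) = 0"
    then have "Re (G (u + of_real d * \<zeta>)) + Re (G u) = 0" by (metis complex_cnj(1) cnj.simps(1) plus_complex.simps(1) zero_complex.simps(1))
    then show False using pos[OF sub[OF that]] Gu by simp
  qed
  have square: "(norm (w - G u))\<^sup>2 = (Re w - Re (G u))\<^sup>2 + (Im w - Im (G u))\<^sup>2"
      "(norm (w + cnj (G u)))\<^sup>2 = (Re w + Re (G u))\<^sup>2 + (Im w - Im (G u))\<^sup>2" for w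
    by (simp_all add: cmod_power2)
  define \<zeta> where "\<zeta> = (z - u) / of_real d"
  have \<zeta>: "norm \<zeta> = s" "u + of_real d * \<zeta> = z" "norm \<zeta> < 1"
    using d s by (auto simp: \<zeta>_def s_def norm_divide dist_norm norm_minus_commute)
  have "norm (W \<zeta>) \<le> norm \<zeta>"
  proof (rule Schwarz_Lemma(1)[OF _ _ _ \<zeta>(3)])
    have "(\<lambda>\<zeta>. G (u + of_real d * \<zeta>)) holomorphic_on ball 0 1"
      by (rule holomorphic_on_compose_gen[OF _ G, unfolded o_def]) (use sub in \<open>auto intro!: holomorphic_intros\<close>)
    then show "W holomorphic_on ball 0 1"
      unfolding W_def using ne by (auto intro!: holomorphic_intros)
    show "W 0 = 0" by (simp add: W_def)
    fix \<xi> :: complex assume \<xi>: "norm \<xi> < 1"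
    let ?w = "G (u + of_real d * \<xi>)"
    have "0 < 4 * (Re ?w * Re (G u))" using pos[OF sub[OF \<xi>]] Gu by simp
    also have "\<dots> = (norm (?w + cnj (G u)))\<^sup>2 - (norm (?w - G u))\<^sup>2"
      unfolding square by (simp add: power2_eq_square algebra_simps)
    finally have "norm (?w - G u) < norm (?w + cnj (G u))"
      by (simp add: power2_less_imp_less)
    then show "norm (W \<xi>) < 1" unfolding W_def norm_divide
      using ne[OF \<xi>] by (subst divide_less_eq_1_pos) auto
  qed
  then have "norm (G z - G u) \<le> s * norm (G z + cnj (G u))"
    using \<zeta> ne[OF \<zeta>(3)] by (simp add: W_def norm_divide divide_le_eq)
  then have "(norm (G z - G u))\<^sup>2 \<le> s\<^sup>2 * (norm (G z + cnj (G u)))\<^sup>2"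
    by (metis norm_ge_zero power_mono power_mult_distrib)
  then have "(Re (G z) - Re (G u))\<^sup>2 + (1 - s\<^sup>2) * (Im (G z) - Im (G u))\<^sup>2 \<le> s\<^sup>2 * (Re (G z) + Re (G u))\<^sup>2"
    unfolding square by (simp add: algebra_simps)
  moreover have "(1 - s\<^sup>2) * (Im (G z) - Im (G u))\<^sup>2 \<ge> 0"
    using s by (intro mult_nonneg_nonneg) (auto simp: power_le_one)
  ultimately have "(Re (G z) - Re (G u))\<^sup>2 \<le> (s * (Re (G z) + Re (G u)))\<^sup>2"
    by (simp add: power_mult_distrib)
  moreover have "s * (Re (G z) + Re (G u)) \<ge> 0" using s Gu pos[of z] z by (simp add: less_imp_le)
  ultimately have "\<bar>Re (G z) - Re (G u)\<bar> \<le> s * (Re (G z) + Re (G u))"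
    using abs_le_square_iff[of "Re (G z) - Re (G u)" "s * (Re (G z) + Re (G u))"] by simp
  then have 1: "(1 - s) * Re (G z) \<le> (1 + s) * Re (G u)" "(1 - s) * Re (G u) \<le> (1 + s) * Re (G z)"
    by (auto simp: algebra_simps abs_le_iff)
  show "(d - dist u z) * Re (G z) \<le> (d + dist u z) * Re (G u)"
    using mult_left_mono[OF 1(1), of d] d by (simp add: s(3) algebra_simps)
  show "(d - dist u z) * Re (G u) \<le> (d + dist u z) * Re (G z)"
    using mult_left_mono[OF 1(2), of d] d by (simp add: s(3) algebra_simps)
qed

text \<open>Here \<open>ln (norm (g z))\<close> is the real part of a holomorphic logarithm, which
  exists because \<open>g\<close> has no zeros on the disc.\<close>

lemma harnack_ln_norm:
  assumes g: "g holomorphic_on ball u d" and big: "\<And>z. z \<in> ball u d \<Longrightarrow> norm (g z) > 1"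
    and z: "dist u z < d"
  shows "(d - dist u z) * ln (norm (g z)) \<le> (d + dist u z) * ln (norm (g u))"
    and "(d - dist u z) * ln (norm (g u)) \<le> (d + dist u z) * ln (norm (g z))"
proof -
  have d: "d > 0" using z zero_le_dist[of u z] by linarith
  have ne: "g z \<noteq> 0" if "z \<in> ball u d" for z using big[OF that] by auto
  obtain L where L: "L holomorphic_on ball u d" "\<And>z. z \<in> ball u d \<Longrightarrow> exp (L z) = g z"
    using holomorphic_logarithm_exists[OF convex_ball open_ball g ne, of u] d by auto
  have Re: "Re (L w) = ln (norm (g w))" if "w \<in> ball u d" for w
    using L(2)[OF that, symmetric] by simp
  have pos: "Re (L w) > 0" if "w \<in> ball u d" for w using ln_gt_zero[OF big[OF that]] Re[OF that] by simp
  show "(d - dist u z) * ln (norm (g z)) \<le> (d + dist u z) * ln (norm (g u))"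
    "(d - dist u z) * ln (norm (g u)) \<le> (d + dist u z) * ln (norm (g z))"
    using harnack_ball[OF L(1) pos z] Re[of z] Re[of u] z d by auto
qed

section \<open>The minimum modulus when low points are sparse, and necessity in (a)\<close>

context transcendental_map begin

text \<open>Under \<open>z = p * exp \<zeta>\<close> the disc of radius \<open>l\<close> maps into
  the annulus, and the circle through \<open>p\<close> comes from the imaginary axis, where a
  preimage of the maximum point lies within \<open>pi\<close> of 0. Harnack's inequality compares
  the two values.\<close>

lemma ln_max_le_ln_min_modulus:
  assumes s: "s > 0" and l: "l > pi"
    and big: "\<And>z. s * exp (- l) < norm z \<Longrightarrow> norm z < s * exp l \<Longrightarrow> norm (f z) > 1"
  shows "(l - pi) * ln (M s) \<le> (l + pi) * ln (m s)"
proof -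
  obtain p where p: "norm p = s" "norm (f p) = m s" using min_modulus_attained(1)[of s] s by auto
  obtain q where q: "norm q = s" "norm (f q) = M s" using max_modulus_attained(1)[of s] s by auto
  define \<theta> where "\<theta> = Arg (q / p)"
  have p0: "p \<noteq> 0" "q \<noteq> 0" using p q s by auto
  have "q / p = exp (\<i> * of_real \<theta>)"
    using Arg_eq[of "q / p"] p0 p q s by (simp add: norm_divide \<theta>_def)
  then have qe: "q = p * exp (\<i> * of_real \<theta>)" using p0 by (simp add: field_simps)
  have \<theta>: "\<bar>\<theta>\<bar> \<le> pi" using Arg_bounded[of "q / p"] by (auto simp: \<theta>_def abs_le_iff)
  define g where "g = (\<lambda>\<zeta>. f (p * exp \<zeta>))"
  have dist: "dist 0 (\<i> * of_real \<theta>) = \<bar>\<theta>\<bar>" by (simp add: norm_mult)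
  have g: "g holomorphic_on ball 0 l" unfolding g_def
    by (rule holomorphic_on_compose_gen[OF _ holo[of UNIV], unfolded o_def]) (auto intro!: holomorphic_intros)
  have gbig: "norm (g \<zeta>) > 1" if "\<zeta> \<in> ball 0 l" for \<zeta>
  proof -
    have "\<bar>Re \<zeta>\<bar> < l" using that abs_Re_le_cmod[of \<zeta>] by simp
    then have "- l < Re \<zeta>" "Re \<zeta> < l" by auto
    then show ?thesis unfolding g_def using s p by (intro big) (simp_all add: norm_mult)
  qed
  have "(l - \<bar>\<theta>\<bar>) * ln (norm (g (\<i> * of_real \<theta>))) \<le> (l + \<bar>\<theta>\<bar>) * ln (norm (g 0))"
    using harnack_ln_norm(1)[OF g gbig, of "\<i> * of_real \<theta>"] \<theta> l unfolding dist by simp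
  then have "(l - \<bar>\<theta>\<bar>) * ln (M s) \<le> (l + \<bar>\<theta>\<bar>) * ln (m s)"
    using p q qe by (simp add: g_def)
  moreover have "norm (g 0) > 1" using gbig[of 0] l pi_gt_zero by (simp del: pi_gt_zero)
  then have ms: "m s > 1" using p by (simp add: g_def)
  then have "ln (m s) \<ge> 0" "ln (M s) \<ge> 0" using min_le_max_modulus[of s] s by auto
  then have "(l - pi) * ln (M s) \<le> (l - \<bar>\<theta>\<bar>) * ln (M s)" "(l + \<bar>\<theta>\<bar>) * ln (m s) \<le> (l + pi) * ln (m s)"
    using \<theta> by (auto intro!: mult_right_mono)
  ultimately show ?thesis by linarith
qed

text \<open>If low points are sparse, then one of two wide annuli just inside the circle of radius
  \<open>exp t\<close> is free of them, and Harnack's inequality there has a constant close to 1.\<close>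

lemma max_min_modulus_lower_bound:
  assumes sparse: "\<And>p p'. \<lbrakk>norm (f p) \<le> 1; norm (f p') \<le> 1; r0 \<le> norm p; 8 * norm p \<le> norm p'\<rbrakk>
                     \<Longrightarrow> (norm p)\<^sup>2 < norm p'"
  shows "\<exists>t0. \<forall>t\<ge>t0. mt (exp t) > 0 \<and> (1 - 8 / sqrt t) * log_max (t - 4 * sqrt t) \<le> ln (mt (exp t))"
proof -
  obtain t1 where t1: "\<And>t. t \<ge> t1 \<Longrightarrow> 0 * t \<le> log_max t" using log_max_superlinear by blast
  define t0 where "t0 = Max {100, 2 * t1, 2 * ln (max r0 1)}"
  have t0: "t0 \<ge> 100" "t0 \<ge> 2 * t1" "t0 \<ge> 2 * ln (max r0 1)" by (auto simp: t0_def)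
  have "mt (exp t) > 0 \<and> (1 - 8 / sqrt t) * log_max (t - 4 * sqrt t) \<le> ln (mt (exp t))" if t: "t \<ge> t0" for t
  proof -
    \<comment> \<open>On the logarithmic scale the two windows are \<open>(t - 5l, t - 3l)\<close>
      and \<open>(t - 2l, t)\<close>. The gap \<open>l\<close> gives ratio at least 8, and
      \<open>10 * l \<le> t\<close>, that is \<open>t \<ge> 100\<close>, makes the square of a low
      point in the first exceed every radius in the second.\<close>
    define l where "l = sqrt t"
    have "sqrt 100 \<le> l" unfolding l_def using t t0 by (intro real_sqrt_le_mono) simp
    moreover have "sqrt 100 = (10::real)" by (rule real_sqrt_unique) auto
    ultimately have l: "l \<ge> 10" "t = l * l" using t t0 by (auto simp: l_def)
    have l10: "10 * l \<le> t" unfolding l(2) using l by (intro mult_right_mono) auto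
    have r0: "r0 \<le> exp (t - 5 * l)"
    proof -
      have "ln (max r0 1) \<le> t - 5 * l" using t t0 l10 by linarith
      then have "exp (ln (max r0 1)) \<le> exp (t - 5 * l)" unfolding exp_le_cancel_iff .
      moreover have "exp (ln (max r0 1)) = max r0 1" by (rule exp_ln) simp
      ultimately show ?thesis by linarith
    qed
    have window: "mt (exp t) > 0 \<and> (1 - 8 / l) * log_max (t - 4 * l) \<le> ln (mt (exp t))"
      if \<tau>: "t - 4 * l \<le> \<tau>" "\<tau> \<le> t"
        and big: "\<And>z. exp (\<tau> - l) < norm z \<Longrightarrow> norm z < exp (\<tau> + l) \<Longrightarrow> norm (f z) > 1" for \<tau>
    proof -
      have pi4: "pi < 4" by (rule pi_less_4)
      have H: "(l - pi) * ln (M (exp \<tau>)) \<le> (l + pi) * ln (m (exp \<tau>))"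
        using l pi4 big by (intro ln_max_le_ln_min_modulus) (auto simp: exp_add[symmetric])
      obtain z where z: "norm z = exp \<tau>" "norm (f z) = m (exp \<tau>)" using min_modulus_attained(1)[of "exp \<tau>"] by auto
      then have ms: "m (exp \<tau>) > 1" using big[of z] l by simp
      have mm: "m (exp \<tau>) \<le> mt (exp t)" using \<tau> by (intro min_le_max_min_modulus) auto
      have lm: "0 \<le> log_max (t - 4 * l)" using t1[of "t - 4 * l"] t t0 l10 by simp
      have mono: "log_max (t - 4 * l) \<le> log_max \<tau>" using \<tau> by (intro log_max_mono)
      have "(l + pi) * ((1 - 8 / l) * log_max (t - 4 * l)) = ((l + pi) * (1 - 8 / l)) * log_max (t - 4 * l)" by simp
      \<comment> \<open>Since \<open>pi < 4\<close>, the Harnack ratio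
        \<open>(l - pi) / (l + pi)\<close> is at least \<open>1 - 8 / l\<close>.\<close>
      also have "\<dots> \<le> (l - pi) * log_max (t - 4 * l)"
      proof (rule mult_right_mono[OF _ lm])
        have "(l + pi) * (1 - 8 / l) = l + pi - 8 - pi * 8 / l" using l by (simp add: field_simps)
        also have "\<dots> \<le> l - pi"
        proof -
          have "0 \<le> pi * 8 / l" using l by simp
          then show ?thesis using pi4 by linarith
        qed
        finally show "(l + pi) * (1 - 8 / l) \<le> l - pi" .
      qed
      also have "\<dots> \<le> (l - pi) * log_max \<tau>" using mono l pi4 by (intro mult_left_mono) auto
      also have "\<dots> \<le> (l + pi) * ln (m (exp \<tau>))" using H by (simp add: log_max_def)
      also have "\<dots> \<le> (l + pi) * ln (mt (exp t))" using mm ms l by (intro mult_left_mono) auto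
      finally have "(1 - 8 / l) * log_max (t - 4 * l) \<le> ln (mt (exp t))"
        using l pi_gt_zero by (simp add: mult_le_cancel_left add_pos_pos del: pi_gt_zero)
      with mm ms show ?thesis by auto
    qed
    have e: "8 \<le> exp l" using exp_ge_add_one_self[of l] l by linarith
    show ?thesis
    proof (cases "\<forall>z. exp (t - 4 * l - l) < norm z \<longrightarrow> norm z < exp (t - 4 * l + l) \<longrightarrow> norm (f z) > 1")
      case True
      then show ?thesis using window[of "t - 4 * l"] l unfolding l_def by simp
    next
      case False
      then obtain p where p: "exp (t - 5 * l) < norm p" "norm p < exp (t - 3 * l)" "norm (f p) \<le> 1"
        by (auto simp: not_less algebra_simps)
      have "norm (f z) > 1" if z: "exp (t - l - l) < norm z" "norm z < exp (t - l + l)" for z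
      proof (rule ccontr)
        assume "\<not> ?thesis"
        moreover have "8 * norm p \<le> norm z"
        proof -
          have "8 * norm p \<le> exp l * exp (t - 3 * l)" using e p by (intro mult_mono) auto
          also have "\<dots> = exp (t - l - l)" by (simp flip: exp_add)
          finally show ?thesis using z by simp
        qed
        ultimately have "(norm p)\<^sup>2 < norm z" using sparse[of p z] p r0 by auto
        also have "\<dots> < exp t" using z by simp
        also have "\<dots> \<le> exp (2 * (t - 5 * l))" using l10 by simp
        also have "\<dots> = (exp (t - 5 * l))\<^sup>2" by (simp add: power2_eq_square flip: exp_add)
        also have "\<dots> \<le> (norm p)\<^sup>2" using p by (intro power_mono) auto
        finally show False by simp
      qed
      then show ?thesis using window[of "t - l"] l unfolding l_def by simp
    qed
  qed
  then show ?thesis by blast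
qed

text \<open>On the logarithmic scale the orbit of \<open>mt\<close> starts ahead of that of
  \<open>M\<close> by the factor 2. A step from \<open>T\<close> costs a relative loss of order
  \<open>1 / sqrt T\<close>; as the orbit of \<open>log_max\<close> grows at least like
  \<open>4^n\<close>, the lead \<open>1 + 1 / 2^n\<close> survives.\<close>

lemma max_min_modulus_dominates:
  assumes sparse: "\<And>p p'. \<lbrakk>norm (f p) \<le> 1; norm (f p') \<le> 1; r0 \<le> norm p; 8 * norm p \<le> norm p'\<rbrakk>
                     \<Longrightarrow> (norm p)\<^sup>2 < norm p'"
  shows "\<exists>T0. \<forall>T\<ge>T0. \<forall>n. (M ^^ n) (exp T) \<le> (mt ^^ n) (exp (2 * T))"
proof -
  obtain t0 where t0: "\<And>t. t \<ge> t0 \<Longrightarrow> mt (exp t) > 0 \<and> (1 - 8 / sqrt t) * log_max (t - 4 * sqrt t) \<le> ln (mt (exp t))"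
    using max_min_modulus_lower_bound[OF sparse] by blast
  define c where "c = \<bar>log_max 0\<bar>"
  obtain t1 where t1: "\<And>t. t \<ge> t1 \<Longrightarrow> (4 + c) * t \<le> log_max t" using log_max_superlinear by blast
  \<comment> \<open>The number 2116 is the square of 46, so that the first step, with
    \<open>\<delta> = 1\<close>, is admissible.\<close>
  define T0 where "T0 = Max {t0, t1, 2116}"
  have T0: "T0 \<ge> t0" "T0 \<ge> t1" "T0 \<ge> 2116" by (auto simp: T0_def)
  have growth: "log_max T \<ge> 4 * T" "log_max T \<ge> c * T" if "T \<ge> T0" for T
  proof -
    have "0 \<le> c * T" "0 \<le> T" using that T0 by (auto simp: c_def)
    moreover have "4 * T + c * T \<le> log_max T" using t1[of T] that T0 by (simp add: algebra_simps)
    ultimately show "log_max T \<ge> 4 * T" "log_max T \<ge> c * T" by linarith+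
  qed
  \<comment> \<open>Half of \<open>\<delta>\<close> pays for a loss of \<open>23 / q\<close>, where
    \<open>q = sqrt T\<close> and \<open>\<phi> = log_max T\<close>: 6 for the shift by
    \<open>4 * sqrt t \<le> 6 * q\<close>, 16 for the factor \<open>1 - 8 / q\<close> against at
    most \<open>2 * \<phi>\<close>, and 1 for the constant
    \<open>c \<le> \<phi> / q\<close>.\<close>
  have step: "exp ((1 + \<delta> / 2) * log_max T) \<le> mt (exp ((1 + \<delta>) * T))"
    if T: "T \<ge> T0" and \<delta>: "46 / sqrt T \<le> \<delta>" "\<delta> \<le> 1" for T \<delta>
  proof -
    define q where "q = sqrt T"
    have Tq: "T = q * q" "q > 0" using T T0 by (auto simp: q_def)
    have q1: "q \<ge> 1" using T T0 unfolding q_def by simp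
    have \<delta>q: "46 / q \<le> \<delta>" using \<delta> by (simp add: q_def)
    have \<delta>0: "\<delta> > 0" using \<delta>q Tq by (meson divide_pos_pos less_le_trans zero_less_numeral)
    define t where "t = (1 + \<delta>) * T"
    define l where "l = sqrt t"
    have tT: "T \<le> t" "t \<le> 2 * T" unfolding t_def using \<delta> \<delta>0 T T0 by (auto simp: mult_right_mono mult_le_cancel_right1)
    have lq: "q \<le> l" unfolding l_def q_def using tT by simp
    have "l \<le> sqrt ((3/2 * q)\<^sup>2)" unfolding l_def using tT Tq by (intro real_sqrt_le_mono) (auto simp: power2_eq_square)
    then have l32: "l \<le> 3/2 * q" using Tq by simp
    define \<phi> where "\<phi> = log_max T"
    have \<phi>: "\<phi> \<ge> 0" "c \<le> \<phi> / q"
    proof -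
      show "\<phi> \<ge> 0" using growth(1)[OF T] T T0 by (simp add: \<phi>_def)
      have "c * q \<le> c * T" unfolding Tq using q1 by (intro mult_left_mono) (auto simp: c_def)
      then have "c * q \<le> \<phi>" using growth(2)[OF T] by (simp add: \<phi>_def)
      then show "c \<le> \<phi> / q" using Tq by (simp add: field_simps)
    qed
    define \<mu> where "\<mu> = 1 + \<delta> - 6 / q"
    have \<mu>: "1 \<le> \<mu>" "\<mu> \<le> 2" using \<delta>q \<delta> Tq divide_right_mono[of 6 46 q] by (auto simp: \<mu>_def)
    have "\<mu> * T = t - 6 * q" using Tq by (simp add: \<mu>_def t_def field_simps)
    then have "\<mu> * T \<le> t - 4 * l" using l32 by linarith
    then have 1: "log_max (\<mu> * T) \<le> log_max (t - 4 * l)" by (rule log_max_mono)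
    have "\<mu> * T * (log_max T - log_max 0) \<le> T * (log_max (\<mu> * T) - log_max 0)"
      using \<mu> T T0 by (intro log_max_convex0) (auto simp: mult_le_cancel_right1)
    then have "T * (\<mu> * (\<phi> - log_max 0)) \<le> T * (log_max (\<mu> * T) - log_max 0)" by (simp add: \<phi>_def algebra_simps)
    then have "\<mu> * (\<phi> - log_max 0) \<le> log_max (\<mu> * T) - log_max 0" using T T0 by simp
    then have "\<mu> * \<phi> - (\<mu> - 1) * log_max 0 \<le> log_max (\<mu> * T)" by (simp add: algebra_simps)
    moreover have "(\<mu> - 1) * log_max 0 \<le> 1 * c"
      using \<mu> by (intro order_trans[OF mult_left_mono[of "log_max 0" c] mult_right_mono]) (auto simp: c_def)
    ultimately have 2: "\<mu> * \<phi> - c \<le> log_max (t - 4 * l)" using 1 by linarith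
    have "8 / q \<le> 46 / q" using Tq by (intro divide_right_mono) auto
    then have q8: "8 / q \<le> 1" using \<delta>q \<delta> by linarith
    have c\<phi>: "c \<le> \<mu> * \<phi>"
    proof -
      have "\<phi> / q \<le> \<phi>" using q1 \<phi>(1) by (simp add: divide_le_eq mult_le_cancel_left1)
      also have "\<dots> \<le> \<mu> * \<phi>" using \<mu> \<phi>(1) by (simp add: mult_le_cancel_right1)
      finally show ?thesis using \<phi>(2) by linarith
    qed
    have "(1 + \<delta> / 2) * \<phi> \<le> (1 + \<delta> - 23 / q) * \<phi>"
      using \<delta>q \<phi>(1) by (intro mult_right_mono) auto
    also have "\<dots> = \<mu> * \<phi> - \<phi> / q - 8 / q * (2 * \<phi>)" using Tq by (simp add: \<mu>_def field_simps)
    also have "\<dots> \<le> \<mu> * \<phi> - c - 8 / q * (\<mu> * \<phi> - c)"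
    proof -
      have "8 / q * (\<mu> * \<phi> - c) \<le> 8 / q * (2 * \<phi>)"
        using \<mu> \<phi>(1) Tq mult_right_mono[of \<mu> 2 \<phi>] by (intro mult_left_mono) (auto simp: c_def)
      then show ?thesis using \<phi>(2) by linarith
    qed
    also have "\<dots> = (1 - 8 / q) * (\<mu> * \<phi> - c)" by (simp add: algebra_simps)
    also have "\<dots> \<le> (1 - 8 / l) * (\<mu> * \<phi> - c)"
      using lq Tq c\<phi> by (intro mult_right_mono) (auto intro!: divide_left_mono)
    also have "\<dots> \<le> (1 - 8 / l) * log_max (t - 4 * l)"
    proof (rule mult_left_mono[OF 2])
      have "8 / l \<le> 8 / q" using lq Tq by (intro divide_left_mono) auto
      then show "0 \<le> 1 - 8 / l" using q8 by linarith
    qed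
    also have "\<dots> \<le> ln (mt (exp t))" using t0[of t] tT T T0 by (simp add: l_def)
    finally have "exp ((1 + \<delta> / 2) * \<phi>) \<le> exp (ln (mt (exp t)))" by simp
    also have "\<dots> = mt (exp t)" using t0[of t] tT T T0 by simp
    finally show ?thesis by (simp add: \<phi>_def t_def)
  qed
  have main: "(M ^^ n) (exp T) \<le> (mt ^^ n) (exp (2 * T))" if T: "T \<ge> T0" for T n
  proof -
    define x where "x n = (log_max ^^ n) T" for n
    have Mx: "(M ^^ n) (exp T) = exp (x n)" for n
      by (induction n) (simp_all add: x_def exp_log_max)
    have x: "x n \<ge> 2116 * 4 ^ n \<and> x n \<ge> T0" for n
    proof (induction n)
      case 0
      then show ?case using T T0 by (simp add: x_def)
    next
      case (Suc n)
      then have "4 * x n \<le> x (Suc n)" using growth(1)[of "x n"] by (simp add: x_def)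
      then show ?case using Suc T0 by auto
    qed
    have "exp ((1 + 1 / 2 ^ n) * x n) \<le> (mt ^^ n) (exp (2 * T))" for n
    proof (induction n)
      case 0
      show ?case by (simp add: x_def)
    next
      case (Suc n)
      have "(2 ^ n)\<^sup>2 = (4::real) ^ n" by (simp add: power2_eq_square flip: power_mult_distrib)
      then have "(46 * 2 ^ n)\<^sup>2 \<le> x n" using x[of n] by (simp add: power_mult_distrib)
      then have sq: "46 * 2 ^ n \<le> sqrt (x n)" by (rule real_le_rsqrt)
      have "x n > 0" using x[of n] T0 by linarith
      then have "46 / sqrt (x n) \<le> 1 / 2 ^ n" using sq by (simp add: field_simps)
      then have "exp ((1 + 1 / 2 ^ n / 2) * log_max (x n)) \<le> mt (exp ((1 + 1 / 2 ^ n) * x n))"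
        using x[of n] by (intro step) auto
      also have "\<dots> \<le> mt ((mt ^^ n) (exp (2 * T)))" using Suc by (intro max_min_modulus_mono) auto
      finally show ?case by (simp add: x_def mult.commute)
    qed
    moreover have "exp (x n) \<le> exp ((1 + 1 / 2 ^ n) * x n)"
      using x[of n] T0 by (simp add: mult_le_cancel_right1)
    ultimately show ?thesis unfolding Mx by (meson order_trans)
  qed
  then show ?thesis by blast
qed

text \<open>If low points are sparse, the comparison of \<open>mt\<close> with \<open>M\<close>
  holds outright. Otherwise low pairs recur, and equality of the two sets excludes an unbounded lag
  by \<open>slow_point_in_V\<close>.\<close>

lemma iterated_moduli_of_V_eq_fast:
  assumes V: "V_radius f R" and eq: "V_set f = fast_escaping_set f"
  shows "\<exists>r R. r \<ge> R \<and> R > 0 \<and> (\<forall>n\<ge>1. (m ^^ n) r \<ge> (M ^^ n) R) \<and>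
               filterlim (\<lambda>n. (M ^^ n) R) at_top sequentially"
proof -
  have R: "R > 0" using V by (simp add: V_radius_def)
  have lim: "filterlim (\<lambda>n. (M ^^ n) R') at_top sequentially" if "R' \<ge> R" for R'
    using fast_escaping_radiusI_V[OF V_radius_mono[OF V that]] by (simp add: fast_escaping_radius_def)
  show ?thesis
  proof (cases "\<exists>r0. \<forall>p p'. norm (f p) \<le> 1 \<longrightarrow> norm (f p') \<le> 1 \<longrightarrow> r0 \<le> norm p \<longrightarrow> 8 * norm p \<le> norm p'
                     \<longrightarrow> (norm p)\<^sup>2 < norm p'")
    case True
    then obtain r0 where "\<And>p p'. \<lbrakk>norm (f p) \<le> 1; norm (f p') \<le> 1; r0 \<le> norm p; 8 * norm p \<le> norm p'\<rbrakk>
                     \<Longrightarrow> (norm p)\<^sup>2 < norm p'" by blast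
    from max_min_modulus_dominates[OF this]
    obtain T0 where T0: "\<And>T n. T \<ge> T0 \<Longrightarrow> (M ^^ n) (exp T) \<le> (mt ^^ n) (exp (2 * T))" by blast
    define T where "T = max (max T0 (ln R)) 0"
    have T: "T \<ge> T0" "T \<ge> ln R" "T \<ge> 0" by (auto simp: T_def)
    have "R \<le> exp T" using T R by (metis exp_le_cancel_iff exp_ln)
    moreover from this have "exp T \<le> exp (2 * T)" "R \<le> exp (2 * T)" using T order_trans[of R "exp T" "exp (2 * T)"] by simp_all
    ultimately show ?thesis
      using T0[OF T(1)] lim[of "exp T"] V_radius_mono[OF V, of "exp (2 * T)"]
      by (intro iterated_min_modulus_of_le[of "exp (2 * T)" "exp T"]) auto
  next
    case False
    obtain v0 where v0: "\<And>v. v \<ge> v0 \<Longrightarrow> itinerary_scale v" using itinerary_scale_exists by blast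
    obtain r3 where r3: "\<And>r. r \<ge> r3 \<Longrightarrow> r ^ 2 \<le> M r" using max_modulus_power by blast
    define v where "v = Max {v0, r3, R}"
    have v: "itinerary_scale v" "r3 \<le> v" "R \<le> v" using v0[of v] by (auto simp: v_def)
    have v_pos: "v > 0" and grow: "\<forall>r\<ge>v. 200 * r \<le> M r" using v by (auto simp: itinerary_scale_def)
    note lv = level_ge[OF v_pos grow]
    have low: "\<exists>j\<ge>J. low_pair v j" for J
    proof -
      from False obtain p p' where p: "norm (f p) \<le> 1" "norm (f p') \<le> 1" "2 * level v J \<le> norm p"
        "8 * norm p \<le> norm p'" "norm p' \<le> (norm p)\<^sup>2" by (metis not_less)
      have "filterlim (\<lambda>n. level v n) at_top sequentially" by (rule lim) (rule v)
      then obtain k where k: "level v k \<ge> norm p" by (rule filterlim_at_top_obtains)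
      \<comment> \<open>The first level whose double exceeds \<open>norm p\<close>. Then
        \<open>norm p' \<le> (norm p)^2\<close> is at most \<open>4 * level v (Suc i)\<close>, and
        the index \<open>j = i - 1\<close> gives a low pair.\<close>
      define i where "i = (LEAST i. norm p < 2 * level v i)"
      have "norm p < 2 * level v k" using k lv(1)[of k] v_pos by linarith
      then have i: "norm p < 2 * level v i" unfolding i_def by (rule LeastI)
      have min: "2 * level v i' \<le> norm p" if "i' < i" for i'
        using that not_less_Least[of i' "\<lambda>i. norm p < 2 * level v i"] unfolding i_def by auto
      have Ji: "J < i"
      proof (rule ccontr)
        assume "\<not> J < i"
        then have "level v i \<le> level v J" by (intro level_mono[OF v_pos grow]) simp
        then show False using i p by simp
      qed
      then obtain j where j: "i = Suc j" by (cases i) auto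
      have "norm p' \<le> (2 * level v i)\<^sup>2" using p(5) i by (meson less_imp_le norm_ge_zero order_trans power_mono)
      also have "\<dots> = 4 * (level v i) ^ 2" by (simp add: power_mult_distrib)
      also have "\<dots> \<le> 4 * M (level v i)" using r3[of "level v i"] lv(1)[of i] v by simp
      also have "\<dots> \<le> 64 * level v (j + 2)" using max_modulus_nonneg[of "level v i"] lv(1)[of i] v_pos j by simp
      finally have "low_pair v j" unfolding low_pair_def using p min[of j] j by blast
      then show ?thesis using Ji j by (intro exI[of _ j]) simp
    qed
    have "\<not> (\<forall>l. \<exists>N. \<forall>n\<ge>N. (mt ^^ n) R \<le> level v (n - l))"
      using slow_point_in_V[OF V v(3,1) low] eq by blast
    then obtain l where l: "\<And>N. \<exists>n\<ge>N. level v (n - l) < (mt ^^ n) R" by (auto simp: not_le)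
    obtain k where k: "(mt ^^ k) R \<ge> v"
      using max_min_modulus_funpow_tendsto[OF V] by (rule filterlim_at_top_obtains)
    define l' where "l' = max k l"
    define R1 where "R1 = (mt ^^ l') R"
    have R1: "v \<le> R1" unfolding R1_def
      using k max_min_modulus_funpow_le[OF V, of k l'] by (simp add: l'_def)
    have "level v n \<le> (mt ^^ n) R1" for n
    proof (rule ccontr)
      \<comment> \<open>Since \<open>mt \<le> M\<close>, a deficit at time \<open>n\<close> persists
        at all later times, whereas the lag \<open>l\<close> is beaten at arbitrarily late
        times.\<close>
      assume less: "\<not> ?thesis"
      obtain n' where n': "n' \<ge> n + l'" "level v (n' - l) < (mt ^^ n') R" using l by blast
      have "(mt ^^ n') R = (mt ^^ (n' - l' - n)) ((mt ^^ n) R1)"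
        using n'(1) by (simp add: R1_def flip: funpow_add comp_apply[of "mt ^^ _"])
      also have "\<dots> \<le> (M ^^ (n' - l' - n)) (level v n)"
        by (rule max_min_le_max_modulus_funpow) (use less R1 v_pos in \<open>auto intro: max_min_modulus_funpow_nonneg\<close>)
      also have "\<dots> = level v (n' - l')" using n'(1) by (simp flip: funpow_add comp_apply[of "M ^^ _"])
      also have "\<dots> \<le> level v (n' - l)" by (intro level_mono[OF v_pos grow]) (simp add: l'_def)
      finally show False using n'(2) by simp
    qed
    then show ?thesis
      using iterated_min_modulus_of_le[OF V_radius_mono[OF V] v_pos R1 lim[OF v(3)]] R1 v(3) by simp
  qed
qed

end

subsection \<open>Spiders' webs\<close>

context transcendental_map begin

lemma closed_preimage_level: "closed ((f ^^ l) -` fast_escaping_level f \<rho>)"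
proof -
  have eq: "(f ^^ l) -` fast_escaping_level f \<rho> = (\<Inter>n\<in>{1..}. {z. (M ^^ n) \<rho> \<le> norm ((f ^^ n) ((f ^^ l) z))})"
    by (auto simp: fast_escaping_level_def)
  have "closed {z. (M ^^ n) \<rho> \<le> norm ((f ^^ n) ((f ^^ l) z))}" for n
    by (intro closed_Collect_le continuous_intros continuous_on_compose2[OF cont_funpow cont_funpow]) auto
  then show ?thesis unfolding eq by (intro closed_INT) auto
qed

text \<open>An orbit that drops below \<open>M^n(\<rho>)\<close> stays below at all later times, so
  the sets \<open>D n\<close> of points not yet below decrease; by compactness one time
  \<open>N\<close> serves all of \<open>Q\<close>.\<close>

lemma compact_disjoint_level:
  assumes Q: "compact Q" and dis: "Q \<inter> (f ^^ l) -` fast_escaping_level f \<rho> = {}"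
  obtains N where "\<And>w. w \<in> Q \<Longrightarrow> norm ((f ^^ N) ((f ^^ l) w)) < (M ^^ N) \<rho>"
proof -
  define D where "D n = Q \<inter> {w. (M ^^ Suc n) \<rho> \<le> norm ((f ^^ Suc n) ((f ^^ l) w))}" for n
  have "\<exists>n. D n = {}"
  proof (rule ccontr)
    assume ne: "\<not> ?thesis"
    have "\<Inter>(range D) \<noteq> {}"
    proof (rule compact_nest)
      show "compact (D n)" for n
      proof -
        have "closed {w. (M ^^ Suc n) \<rho> \<le> norm ((f ^^ Suc n) ((f ^^ l) w))}"
          by (intro closed_Collect_le continuous_intros continuous_on_compose2[OF cont_funpow cont_funpow]) auto
        then show ?thesis unfolding D_def by (intro compact_Int_closed Q)
      qed
      show "D n \<noteq> {}" for n using ne by blast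
      have "D (Suc n) \<subseteq> D n" for n
      proof
        fix w assume w: "w \<in> D (Suc n)"
        have "(M ^^ Suc n) \<rho> \<le> norm ((f ^^ Suc n) ((f ^^ l) w))"
        proof (rule ccontr)
          assume "\<not> ?thesis"
          then have "norm (f ((f ^^ Suc n) ((f ^^ l) w))) < M ((M ^^ Suc n) \<rho>)"
            by (intro norm_less_max_modulus) simp
          then show False using w by (simp add: D_def)
        qed
        then show "w \<in> D n" using w by (simp add: D_def)
      qed
      then show "D n \<subseteq> D k" if "k \<le> n" for k n using lift_Suc_antimono_le[of D, OF _ that] by blast
    qed
    then obtain w where w: "\<And>n. w \<in> D n" by blast
    have "(M ^^ n) \<rho> \<le> norm ((f ^^ n) ((f ^^ l) w))" if "n \<ge> 1" for n
      using w[of "n - 1"] that by (simp add: D_def)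
    then have "w \<in> Q \<inter> (f ^^ l) -` fast_escaping_level f \<rho>"
      using w[of 0] by (auto simp: D_def fast_escaping_level_def)
    with dis show False by blast
  qed
  then obtain n where "D n = {}" by blast
  then have "norm ((f ^^ Suc n) ((f ^^ l) w)) < (M ^^ Suc n) \<rho>" if "w \<in> Q" for w
    using that unfolding D_def by (force simp: not_le)
  then show ?thesis by (rule that)
qed

text \<open>A bounded component could be surrounded by the frontier of a bounded open set off the
  level set. There the iterates are below \<open>M^N(\<rho>)\<close> at a common time
  \<open>N\<close>, and the maximum principle carries this inside.\<close>

lemma unbounded_components_level:
  assumes \<rho>: "\<rho> > 0" and C: "C \<in> components ((f ^^ l) -` fast_escaping_level f \<rho>)"
  shows "\<not> bounded C"
proof
  assume bC: "bounded C"
  define F where "F = (f ^^ l) -` fast_escaping_level f \<rho>"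
  have clF: "closed F" unfolding F_def by (rule closed_preimage_level)
  have C': "C \<in> components F" using C by (simp add: F_def)
  have "compact C" using bC closed_components[OF clF C'] by (simp add: compact_eq_bounded_closed)
  obtain z where z: "z \<in> C" "z \<in> F" using in_components_nonempty[OF C'] in_components_subset[OF C'] by blast
  \<comment> \<open>By the Sura-Bura theorem the component lies in a compact, relatively open subset
    of \<open>F\<close>, which has positive distance from the rest of \<open>F\<close>.\<close>
  obtain K where K: "openin (top_of_set F) K" "compact K" "C \<subseteq> K" "K \<subseteq> UNIV"
    by (rule Sura_Bura_clopen_subset[OF closed_imp_locally_compact[OF clF] C' \<open>compact C\<close> open_UNIV subset_UNIV])
  have KF: "K \<subseteq> F" using K(1) openin_imp_subset by blast
  have "closedin (top_of_set F) (F - K)" using K(1) by (simp add: openin_closedin_eq)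
  then have "closed (F - K)" using clF closedin_closed_trans by blast
  then obtain d where d: "d > 0" "\<And>x y. x \<in> K \<Longrightarrow> y \<in> F - K \<Longrightarrow> d \<le> dist x y"
    using separate_compact_closed[OF K(2), of "F - K"] by blast
  have Kne: "K \<noteq> {}" using z K by blast
  define G where "G = {x. infdist x K < d / 2}"
  have opG: "open G" unfolding G_def by (intro open_Collect_less continuous_intros)
  have "closed {x. infdist x K \<le> d / 2}" by (intro closed_Collect_le continuous_intros)
  then have "closure G \<subseteq> {x. infdist x K \<le> d / 2}" by (intro closure_minimal) (auto simp: G_def)
  then have fr: "infdist x K = d / 2" if "x \<in> frontier G" for x
    using that opG by (auto simp: frontier_def interior_open G_def)
  have frF: "frontier G \<inter> F = {}"
  proof (rule ccontr)
    assume "\<not> ?thesis"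
    then obtain x where x: "x \<in> frontier G" "x \<in> F" by blast
    then have "x \<notin> K" using fr[OF x(1)] d infdist_zero by fastforce
    then have "d \<le> infdist x K"
      unfolding infdist_notempty[OF Kne] using x d(2) Kne by (intro cINF_greatest) (auto simp: dist_commute)
    then show False using fr[OF x(1)] d by simp
  qed
  obtain B where B: "\<And>x. x \<in> K \<Longrightarrow> norm x \<le> B"
    using compact_imp_bounded[OF K(2)] bounded_iff by metis
  have bG: "bounded G"
  proof (rule boundedI[of _ "B + d"])
    fix x assume "x \<in> G"
    obtain y where "y \<in> K" "infdist x K = dist x y"
      by (rule infdist_attains_inf[OF compact_imp_closed[OF K(2)] Kne])
    moreover from this have "dist x y < d / 2" using \<open>x \<in> G\<close> by (simp add: G_def)
    ultimately show "norm x \<le> B + d"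
      using B[of y] norm_triangle_ineq2[of x y] d(1) by (simp add: dist_norm)
  qed
  have cfr: "compact (frontier G)" using bG by (rule compact_frontier_bounded)
  obtain N where N: "\<And>w. w \<in> frontier G \<Longrightarrow> norm ((f ^^ N) ((f ^^ l) w)) < (M ^^ N) \<rho>"
    using compact_disjoint_level[OF cfr, of l \<rho>] frF unfolding F_def by blast
  define h where "h w = (f ^^ N) ((f ^^ l) w)" for w
  have h: "h holomorphic_on A" "continuous_on A h" for A
    unfolding h_def using holo_funpow[of "N + l"] cont_funpow[of _ "N + l"] by (auto simp: funpow_add o_def)
  have MN: "(M ^^ N) \<rho> > 0" using \<rho> by (induction N) (auto intro: max_modulus_pos)
  obtain b where b: "b < (M ^^ N) \<rho>" "\<And>w. w \<in> frontier G \<Longrightarrow> norm (h w) \<le> b"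
  proof (cases "frontier G = {}")
    case True
    then show ?thesis using that[of 0] MN by auto
  next
    case False
    obtain w where w: "w \<in> frontier G" "\<forall>v\<in>frontier G. norm (h v) \<le> norm (h w)"
      using continuous_attains_sup[OF cfr False, of "\<lambda>w. norm (h w)"] h(2) continuous_on_norm by blast
    then show ?thesis using that[of "norm (h w)"] N[of w] by (auto simp: h_def)
  qed
  have "norm (h z) \<le> b"
  proof (rule maximum_modulus_frontier[where f = h and S = G and \<xi> = z])
    show "z \<in> G" unfolding G_def using z K d by auto
  qed (use h b bG in auto)
  moreover have "(M ^^ N) \<rho> \<le> norm (h z)" if "N \<ge> 1"
    using z(2) that by (auto simp: F_def fast_escaping_level_def h_def)
  \<comment> \<open>Level sets impose no condition at time 0, so this case is excluded by one
    further application of \<open>f\<close>.\<close>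
  ultimately have "N = 0" using b(1) by (cases N) auto
  have "norm (f (h z)) < M \<rho>"
    using \<open>norm (h z) \<le> b\<close> b(1) \<open>N = 0\<close> by (intro norm_less_max_modulus) simp
  moreover have "M \<rho> \<le> norm (f (h z))"
  proof -
    have "(M ^^ 1) \<rho> \<le> norm ((f ^^ 1) ((f ^^ l) z))"
      using z(2) by (simp add: F_def fast_escaping_level_def del: funpow.simps One_nat_def)
    then show ?thesis using \<open>N = 0\<close> by (simp add: h_def)
  qed
  ultimately show False by simp
qed

text \<open>If uniform escape failed, normality would apply to a sequence of failures: a finite
  limit of a subsequence is excluded at \<open>x\<close>, an infinite one on
  \<open>K\<close>.\<close>

lemma escaping_uniform_on_normal:
  assumes nf: "normal_family_on U {f ^^ n | n. n \<ge> 1}" and x: "x \<in> U" "x \<in> escaping_set f"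
    and K: "compact K" "K \<subseteq> U"
  obtains n0 where "\<And>n y. n \<ge> n0 \<Longrightarrow> y \<in> K \<Longrightarrow> norm ((f ^^ n) y) > B"
proof -
  have "\<exists>n0. \<forall>n\<ge>n0. \<forall>y\<in>K. norm ((f ^^ n) y) > B"
  proof (rule ccontr)
    assume no: "\<not> ?thesis"
    define S where "S = {n. n \<ge> 1 \<and> (\<exists>y\<in>K. norm ((f ^^ n) y) \<le> B)}"
    have "infinite S"
      unfolding infinite_nat_iff_unbounded_le
    proof
      fix k
      have "\<exists>n\<ge>Suc k. \<exists>y\<in>K. norm ((f ^^ n) y) \<le> B" using no by (auto simp: not_less)
      then obtain n where "n \<ge> Suc k" "\<exists>y\<in>K. norm ((f ^^ n) y) \<le> B" by blast
      then show "\<exists>n\<ge>k. n \<in> S" by (intro exI[of _ n]) (auto simp: S_def)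
    qed
    then obtain \<tau> :: "nat \<Rightarrow> nat" where \<tau>: "strict_mono \<tau>" "\<And>k. \<tau> k \<in> S"
      using infinite_enumerate by blast
    have fam: "\<forall>k. f ^^ \<tau> k \<in> {f ^^ n | n. n \<ge> 1}" using \<tau>(2) by (auto simp: S_def)
    from nf[unfolded normal_family_on_def, rule_format, of "\<lambda>k. f ^^ \<tau> k", OF fam[rule_format]]
    obtain \<sigma> where \<sigma>: "strict_mono \<sigma>" and alt:
      "(\<exists>g. g holomorphic_on U \<and> (\<forall>K. compact K \<and> K \<subseteq> U \<longrightarrow> uniform_limit K (\<lambda>k. f ^^ \<tau> (\<sigma> k)) g sequentially)) \<or>
       (\<forall>K. compact K \<and> K \<subseteq> U \<longrightarrow> (\<forall>B. \<forall>\<^sub>F k in sequentially. \<forall>z\<in>K. norm ((f ^^ \<tau> (\<sigma> k)) z) > B))"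
      by blast
    show False using alt
    proof
      assume "\<exists>g. g holomorphic_on U \<and> (\<forall>K. compact K \<and> K \<subseteq> U \<longrightarrow> uniform_limit K (\<lambda>k. f ^^ \<tau> (\<sigma> k)) g sequentially)"
      then obtain g where "uniform_limit {x} (\<lambda>k. f ^^ \<tau> (\<sigma> k)) g sequentially" using x by (metis compact_sing empty_subsetI insert_subset)
      then have "(\<lambda>k. (f ^^ \<tau> (\<sigma> k)) x) \<longlonglongrightarrow> g x" by (rule tendsto_uniform_limitI) simp
      moreover have "filterlim (\<lambda>k. (f ^^ \<tau> (\<sigma> k)) x) at_infinity sequentially"
      proof -
        have "filterlim (\<lambda>k. \<tau> (\<sigma> k)) sequentially sequentially"
          using filterlim_subseq[OF strict_mono_o[OF \<tau>(1) \<sigma>]] by (simp add: o_def)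
        then show ?thesis
          using x(2) filterlim_compose unfolding escaping_set_def by blast
      qed
      ultimately show False using not_tendsto_and_filterlim_at_infinity[OF sequentially_bot] by blast
    next
      assume "\<forall>K. compact K \<and> K \<subseteq> U \<longrightarrow> (\<forall>B. \<forall>\<^sub>F k in sequentially. \<forall>z\<in>K. norm ((f ^^ \<tau> (\<sigma> k)) z) > B)"
      then have "\<forall>\<^sub>F k in sequentially. \<forall>z\<in>K. norm ((f ^^ \<tau> (\<sigma> k)) z) > B" using K by blast
      then obtain k where "\<forall>z\<in>K. norm ((f ^^ \<tau> (\<sigma> k)) z) > B" unfolding eventually_sequentially by blast
      moreover have "\<exists>y\<in>K. norm ((f ^^ \<tau> (\<sigma> k)) y) \<le> B" using \<tau>(2)[of "\<sigma> k"] by (simp add: S_def)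
      ultimately show False by force
    qed
  qed
  then show ?thesis using that by blast
qed

text \<open>On a Fatou component that meets the escaping set, the functions \<open>ln (norm (f ^^ n))\<close> are
  eventually positive and harmonic near every point, so Harnack's inequality chains.\<close>

lemma escaping_rate_on_Fatou_component:
  assumes C: "C \<in> components (Fatou_set f)" and z': "z' \<in> C" "z' \<in> escaping_set f" and z: "z \<in> C"
  shows "z \<in> escaping_set f \<and> (\<exists>K n0. K > 0 \<and> (\<forall>n\<ge>n0. ln (norm ((f ^^ n) z')) \<le> K * ln (norm ((f ^^ n) z))))"
proof -
  define P where "P w \<longleftrightarrow> w \<in> escaping_set f \<and> (\<exists>K n0. K > 0 \<and> (\<forall>n\<ge>n0. ln (norm ((f ^^ n) z')) \<le> K * ln (norm ((f ^^ n) w))))" for w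
  have "P z"
  proof (rule connected_induction_simple[OF in_components_connected[OF C] z'(1) z])
    show "P z'" unfolding P_def
      using z' by (auto intro!: exI[of _ "1::real"])
    fix a assume "a \<in> C"
    then have "a \<in> Fatou_set f" using in_components_subset[OF C] by blast
    then obtain U where U: "open U" "a \<in> U" "normal_family_on U {f ^^ n | n. n \<ge> 1}"
      unfolding Fatou_set_def by blast
    obtain \<delta> where \<delta>: "\<delta> > 0" "cball a \<delta> \<subseteq> U" using U open_contains_cball by metis
    define T where "T = C \<inter> ball a (\<delta> / 4)"
    have step: "P y" if xy: "x \<in> T" "y \<in> T" and Px: "P x" for x y
      unfolding P_def
    proof
      obtain K n0 where K: "K > 0" "\<And>n. n \<ge> n0 \<Longrightarrow> ln (norm ((f ^^ n) z')) \<le> K * ln (norm ((f ^^ n) x))"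
        using Px unfolding P_def by blast
      have x: "x \<in> escaping_set f" using Px unfolding P_def by blast
      have xa: "dist a x < \<delta> / 4" "dist a y < \<delta> / 4" using xy by (auto simp: T_def)
      have xU: "x \<in> U" using xa(1) \<delta> by (intro subsetD[OF \<delta>(2)]) simp
      have big: "\<exists>n1. \<forall>n\<ge>n1. \<forall>y\<in>cball a \<delta>. norm ((f ^^ n) y) > B" for B
        using escaping_uniform_on_normal[OF U(3) xU x compact_cball \<delta>(2), of B] by metis
      show "y \<in> escaping_set f"
        unfolding escaping_set_def filterlim_at_infinity[OF order_refl] mem_Collect_eq eventually_sequentially
      proof (intro allI impI)
        fix B :: real
        obtain n1 where "\<forall>n\<ge>n1. \<forall>y\<in>cball a \<delta>. norm ((f ^^ n) y) > B" using big by blast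
        moreover have "y \<in> cball a \<delta>" using xa \<delta> by simp
        ultimately show "\<exists>N. \<forall>n\<ge>N. B \<le> norm ((f ^^ n) y)" by (meson less_imp_le)
      qed
      obtain n1 where n1: "\<And>n y. n \<ge> n1 \<Longrightarrow> y \<in> cball a \<delta> \<Longrightarrow> norm ((f ^^ n) y) > 1" using big[of 1] by blast
      have sub: "ball x (3/4 * \<delta>) \<subseteq> cball a \<delta>"
      proof
        fix w assume "w \<in> ball x (3/4 * \<delta>)"
        then show "w \<in> cball a \<delta>" using dist_triangle[of a w x] xa by simp
      qed
      have dxy: "dist x y \<le> \<delta> / 2" using dist_triangle[of x y a] xa by (simp add: dist_commute)
      have "ln (norm ((f ^^ n) z')) \<le> 5 * K * ln (norm ((f ^^ n) y))" if n: "n \<ge> max n0 n1" for n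
      proof -
        have b: "norm ((f ^^ n) w) > 1" if "w \<in> ball x (3/4 * \<delta>)" for w using n1[of n w] n that sub by auto
        have d: "dist x y < 3/4 * \<delta>" using dxy \<delta> by linarith
        have H: "(3/4 * \<delta> - dist x y) * ln (norm ((f ^^ n) x)) \<le> (3/4 * \<delta> + dist x y) * ln (norm ((f ^^ n) y))"
          by (rule harnack_ln_norm(2)[OF holo_funpow b d])
        have pos: "ln (norm ((f ^^ n) x)) \<ge> 0" "ln (norm ((f ^^ n) y)) \<ge> 0"
          using b[of x] b[of y] d \<delta> by (auto simp: less_imp_le)
        \<comment> \<open>Since \<open>dist x y \<le> \<delta> / 2\<close>, the Harnack ratio is at
          most \<open>(5/4) / (1/4) = 5\<close>.\<close>
        have "\<delta> / 4 * ln (norm ((f ^^ n) x)) \<le> (3/4 * \<delta> - dist x y) * ln (norm ((f ^^ n) x))"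
          using dxy by (intro mult_right_mono pos) simp
        also have "\<dots> \<le> (3/4 * \<delta> + dist x y) * ln (norm ((f ^^ n) y))" by (rule H)
        also have "\<dots> \<le> \<delta> / 4 * (5 * ln (norm ((f ^^ n) y)))"
          using dxy mult_right_mono[of "3/4 * \<delta> + dist x y" "5/4 * \<delta>", OF _ pos(2)] by simp
        finally have "ln (norm ((f ^^ n) x)) \<le> 5 * ln (norm ((f ^^ n) y))" using \<delta>(1) by simp
        then have "K * ln (norm ((f ^^ n) x)) \<le> K * (5 * ln (norm ((f ^^ n) y)))" using K(1) by simp
        then show ?thesis using K(2)[of n] n by simp
      qed
      then show "\<exists>K n0. K > 0 \<and> (\<forall>n\<ge>n0. ln (norm ((f ^^ n) z')) \<le> K * ln (norm ((f ^^ n) y)))"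
        using K(1) by (intro exI[of _ "5 * K"] exI[of _ "max n0 n1"]) auto
    qed
    have "openin (top_of_set C) T" "a \<in> T" using \<open>a \<in> C\<close> \<delta> by (auto simp: T_def openin_open_Int)
    then show "\<exists>T. openin (top_of_set C) T \<and> a \<in> T \<and> (\<forall>x\<in>T. \<forall>y\<in>T. P x \<longrightarrow> P y)"
    proof (intro exI[of _ T] conjI ballI impI)
      show "P y" if "x \<in> T" "y \<in> T" "P x" for x y using that by (rule step)
    qed
  qed
  then show ?thesis by (simp add: P_def)
qed

end

section \<open>Consequences of the condition on the iterated moduli\<close>

locale fast_min_modulus = transcendental_map +
  fixes r R :: real
  assumes Rr: "R \<le> r" and R_pos: "R > 0"
    and min_ge_max: "\<And>n. n \<ge> 1 \<Longrightarrow> (M ^^ n) R \<le> (m ^^ n) r"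
    and level_tendsto: "filterlim (\<lambda>n. (M ^^ n) R) at_top sequentially"
begin

lemma level_le_min: "level R n \<le> (m ^^ n) r"
  using Rr min_ge_max[of n] by (cases n) auto

lemma level_pos: "level R n > 0"
  using R_pos by (induction n) (auto intro: max_modulus_pos)

text \<open>If \<open>M R < R\<close>, monotonicity of \<open>M\<close> would keep the whole orbit
  at or below \<open>R\<close>. So the first step does not go down, and monotonicity passes this on
  to the later steps.\<close>

lemma level_incr: "i \<le> j \<Longrightarrow> level R i \<le> level R j"
proof (rule lift_Suc_mono_le[of "\<lambda>n. level R n"])
  have "R \<le> M R"
  proof (rule ccontr)
    assume "\<not> R \<le> M R"
    then have le: "level R n \<le> R" for n
    proof (induction n)
      case (Suc n)
      then have "M (level R n) \<le> M R" using level_pos[of n] by (intro max_modulus_mono) auto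
      then show ?case using \<open>\<not> R \<le> M R\<close> by simp
    qed auto
    obtain k where "level R k \<ge> R + 1" using filterlim_at_top_obtains[OF level_tendsto] .
    with le[of k] show False by simp
  qed
  then show "level R n \<le> level R (Suc n)" for n
    using max_modulus_funpow_mono[of R "M R" n] R_pos by (simp add: funpow_swap1)
qed

abbreviation "F k \<equiv> fast_escaping_level f (level R k)"

lemma mem_F: "z \<in> F k \<longleftrightarrow> (\<forall>n\<ge>1. level R (n + k) \<le> norm ((f ^^ n) z))"
  by (simp add: fast_escaping_level_def funpow_add)

lemma closed_F: "closed (F k)"
  using closed_preimage_level[of 0] by simp

lemma F_antimono: "i \<le> k \<Longrightarrow> F k \<subseteq> F i"
  unfolding subset_iff mem_F by (meson add_left_mono level_incr order_trans)

lemma fast_radius: "fast_escaping_radius f R"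
  using R_pos level_tendsto by (simp add: fast_escaping_radius_def)

lemma F_subset_fast: "F k \<subseteq> fast_escaping_set f"
proof -
  have "F 0 \<subseteq> fast_escaping_set f" unfolding fast_escaping_set_eq[OF fast_radius] by (auto intro!: exI[of _ 0])
  then show ?thesis using F_antimono[of 0 k] by auto
qed

definition web :: "nat \<Rightarrow> complex set" where
  "web k = connected_component_set (- F k) 0"

lemma open_web: "open (web k)"
  unfolding web_def using closed_F by (intro open_connected_component) (simp add: open_Compl)

lemma connected_web: "connected (web k)"
  unfolding web_def by simp

lemma ball_subset_web: "ball 0 (level R k) \<subseteq> web k"
  unfolding web_def
proof (rule connected_component_maximal)
  show "0 \<in> ball (0::complex) (level R k)" using level_pos by simp
  show "ball 0 (level R k) \<subseteq> - F k"
  proof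
    fix z :: complex assume "z \<in> ball 0 (level R k)"
    then have "norm ((f ^^ 1) z) < (M ^^ 1) (level R k)" by (intro norm_funpow_less_max_modulus) simp
    then show "z \<in> - F k" unfolding fast_escaping_level_def by (force simp: not_le)
  qed
qed simp

text \<open>Take a compact connected set in \<open>web k\<close> from 0 to a point of modulus at
  least \<open>m^k(r)\<close>. At every time its image meets the circle of radius
  \<open>m^(n+k)(r)\<close>, because the image of 0 does not lie beyond it. Compactness turns
  avoidance of \<open>F k\<close> into a single time \<open>N\<close>, at which this is
  impossible.\<close>

lemma web_subset_ball: "web k \<subseteq> ball 0 ((m ^^ k) r)"
proof
  fix q assume q: "q \<in> web k"
  show "q \<in> ball 0 ((m ^^ k) r)"
  proof (rule ccontr)
    assume "q \<notin> ball 0 ((m ^^ k) r)"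
    then have qr: "(m ^^ k) r \<le> norm q" by simp
    have 0: "0 \<in> web k" using ball_subset_web[of k] level_pos[of k] by auto
    obtain g where g: "path g" "path_image g \<subseteq> web k" "pathstart g = 0" "pathfinish g = q"
      using connected_open_path_connected[OF open_web connected_web] 0 q
      unfolding path_connected_def by blast
    define Q where "Q = path_image g"
    have Q: "compact Q" "connected Q" "0 \<in> Q" "q \<in> Q" "Q \<subseteq> - F k"
    proof -
      show "compact Q" "connected Q" "0 \<in> Q" "q \<in> Q"
        using g pathstart_in_path_image[of g] pathfinish_in_path_image[of g]
        by (simp_all add: Q_def compact_path_image connected_path_image)
      show "Q \<subseteq> - F k"
        using g(2) connected_component_subset[of "- F k" 0] unfolding Q_def web_def by (rule subset_trans)
    qed
    have cross: "\<exists>w\<in>Q. (m ^^ (n + k)) r \<le> norm ((f ^^ n) w)" for n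
    proof (induction n)
      case 0
      then show ?case using Q qr by auto
    next
      case (Suc n)
      let ?s = "(m ^^ (n + k)) r"
      have con: "connected ((\<lambda>w. norm ((f ^^ n) w)) ` Q)"
        by (intro connected_continuous_image Q continuous_intros cont_funpow)
      have "norm ((f ^^ n) 0) \<le> level (level R k) n"
        by (rule norm_funpow_le_max_modulus) (use level_pos[of k] in simp)
      also have "\<dots> = level R (n + k)" by (simp add: funpow_add)
      also have "\<dots> \<le> ?s" by (rule level_le_min)
      finally have lo: "norm ((f ^^ n) 0) \<le> ?s" .
      obtain w where w: "w \<in> Q" "?s \<le> norm ((f ^^ n) w)" using Suc by blast
      have "?s \<in> (\<lambda>w. norm ((f ^^ n) w)) ` Q"
        by (rule connectedD_interval[OF con _ _ lo w(2)]) (use Q w in auto)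
      then obtain u where u: "u \<in> Q" "norm ((f ^^ n) u) = ?s" by auto
      have "m ?s \<le> norm (f ((f ^^ n) u))"
        using min_modulus_attained(2)[of ?s "(f ^^ n) u"] u(2) norm_ge_zero by metis
      then show ?case using u(1) by auto
    qed
    obtain N where N: "\<And>w. w \<in> Q \<Longrightarrow> norm ((f ^^ N) ((f ^^ 0) w)) < (M ^^ N) (level R k)"
      using compact_disjoint_level[OF Q(1), of 0 "level R k"] Q(5) by auto
    obtain w where w: "w \<in> Q" "(m ^^ (N + k)) r \<le> norm ((f ^^ N) w)" using cross by blast
    have "level R (N + k) \<le> norm ((f ^^ N) w)" using w(2) level_le_min[of "N + k"] by simp
    then show False using N[OF w(1)] by (simp add: funpow_add)
  qed
qed

lemma bounded_web: "bounded (web k)"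
  using web_subset_ball bounded_ball bounded_subset by blast

lemma frontier_web: "frontier (web k) \<subseteq> F k"
proof -
  have "frontier (web k) \<subseteq> frontier (- F k)" unfolding web_def by (rule frontier_of_connected_component_subset)
  then show ?thesis using closed_F[of k] by (simp add: frontier_complement frontier_subset_closed subset_trans)
qed

lemma web_mono: "i \<le> k \<Longrightarrow> web i \<subseteq> web k"
  unfolding web_def using F_antimono by (intro connected_component_mono) blast

lemma web_exhausts: "\<exists>k. z \<in> web k"
proof -
  obtain k where "level R k \<ge> norm z + 1" using filterlim_at_top_obtains[OF level_tendsto] .
  then have "z \<in> ball 0 (level R k)" by simp
  then show ?thesis using ball_subset_web by blast
qed

text \<open>A bounded complementary component would have a boundary point in \<open>F k\<close>, and
  the component of \<open>F k\<close> through that point is unbounded yet confined to the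
  complementary component.\<close>

lemma simply_connected_web: "simply_connected (web k)"
  unfolding simply_connected_eq_unbounded_complement_components[OF open_web]
proof (intro conjI connected_web ballI)
  fix C assume C: "C \<in> components (- web k)"
  show "\<not> bounded C"
  proof
    assume bC: "bounded C"
    have clC: "closed C" using C open_web by (intro closed_components[OF _ C]) (simp add: closed_Compl)
    have "C \<noteq> {}" "C \<noteq> UNIV" using in_components_nonempty[OF C] bC not_bounded_UNIV by auto
    then have "frontier C \<noteq> {}" by (simp add: frontier_eq_empty)
    then obtain y where y: "y \<in> frontier C" by blast
    have yC: "y \<in> C" using y clC frontier_subset_closed by blast
    have yF: "y \<in> F k"
    proof (rule ccontr)
      \<comment> \<open>Otherwise the component of \<open>y\<close> off \<open>F k\<close> is open
        and misses \<open>web k\<close>, so it lies in \<open>C\<close> and \<open>y\<close> is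
        interior.\<close>
      assume "y \<notin> F k"
      define H where "H = connected_component_set (- F k) y"
      have H: "open H" "connected H" "y \<in> H"
        unfolding H_def using closed_F[of k] \<open>y \<notin> F k\<close> by (auto intro: open_connected_component simp: open_Compl)
      have "y \<notin> web k" using yC in_components_subset[OF C] by blast
      then have "H \<inter> web k = {}" unfolding H_def web_def
        using connected_component_nonoverlap[of "- F k" y 0] connected_component_eq by (metis ComplI \<open>y \<notin> F k\<close> connected_component_refl_eq mem_Collect_eq)
      then have "H \<subseteq> C" using H yC by (intro components_maximal[OF C]) auto
      then have "y \<in> interior C" using H interior_maximal by blast
      then show False using y by (simp add: frontier_def)
    qed
    define D where "D = connected_component_set (F k) y"
    have D: "D \<in> components (F k)" using yF unfolding D_def by (rule componentsI)
    have "\<not> bounded D"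
      using unbounded_components_level[of "level R k" D 0] level_pos D by simp
    moreover have "D \<subseteq> C"
    proof (rule components_maximal[OF C])
      show "connected D" unfolding D_def by simp
      show "D \<subseteq> - web k"
        using in_components_subset[OF D] connected_component_subset[of "- F k" 0] unfolding web_def by blast
      show "C \<inter> D \<noteq> {}" using yC yF unfolding D_def by auto
    qed
    ultimately show False using bC bounded_subset by blast
  qed
qed

lemma connected_frontier_web: "connected (frontier (web k))"
  using simply_connected_web[of k] bounded_web[of k]
  by (simp add: simply_connected_eq_frontier_properties[OF open_web])

lemma unbounded_meets_frontier_web:
  assumes "connected D" "\<not> bounded D" "D \<inter> web k \<noteq> {}"
  shows "D \<inter> frontier (web k) \<noteq> {}"
proof (rule connected_Int_frontier[OF assms(1,3)])
  show "D - web k \<noteq> {}" using assms(2) bounded_web bounded_subset by blast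
qed

lemma fast_escaping_cases:
  assumes "z \<in> fast_escaping_set f"
  obtains D where "connected D" "\<not> bounded D" "z \<in> D" "D \<subseteq> fast_escaping_set f"
proof -
  obtain l where l: "z \<in> (f ^^ l) -` fast_escaping_level f R"
    using assms unfolding fast_escaping_set_eq[OF fast_radius] by blast
  define D where "D = connected_component_set ((f ^^ l) -` fast_escaping_level f R) z"
  have D: "D \<in> components ((f ^^ l) -` fast_escaping_level f R)" unfolding D_def using l by (rule componentsI)
  show ?thesis
  proof
    show "connected D" unfolding D_def by simp
    show "\<not> bounded D" using unbounded_components_level[OF R_pos D] .
    show "z \<in> D" unfolding D_def using l by simp
    show "D \<subseteq> fast_escaping_set f"
      using in_components_subset[OF D] unfolding fast_escaping_set_eq[OF fast_radius] by blast
  qed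
qed

text \<open>Each point lies on an unbounded connected subset of \<open>A(f)\<close>, which must
  leave any \<open>web k\<close> containing the point and so meets its connected frontier. For two
  points one frontier serves both.\<close>

lemma connected_fast_escaping: "connected (fast_escaping_set f)"
  unfolding connected_iff_connected_component
proof (intro ballI)
  fix z z' assume "z \<in> fast_escaping_set f" "z' \<in> fast_escaping_set f"
  then obtain D D' where D: "connected D" "\<not> bounded D" "z \<in> D" "D \<subseteq> fast_escaping_set f"
    and D': "connected D'" "\<not> bounded D'" "z' \<in> D'" "D' \<subseteq> fast_escaping_set f"
    by (meson fast_escaping_cases)
  obtain k k' where "z \<in> web k" "z' \<in> web k'" using web_exhausts by meson
  then have "z \<in> web (max k k')" "z' \<in> web (max k k')"
    using web_mono[of k "max k k'"] web_mono[of k' "max k k'"] by auto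
  then have "D \<inter> frontier (web (max k k')) \<noteq> {}" "D' \<inter> frontier (web (max k k')) \<noteq> {}"
    using unbounded_meets_frontier_web[OF D(1,2), of "max k k'"]
      unbounded_meets_frontier_web[OF D'(1,2), of "max k k'"] D(3) D'(3) by blast+
  then have "connected (D \<union> frontier (web (max k k')) \<union> D')"
    using D(1) D'(1) connected_frontier_web[of "max k k'"] by (intro connected_Un) auto
  moreover have "D \<union> frontier (web (max k k')) \<union> D' \<subseteq> fast_escaping_set f"
    using D(4) D'(4) frontier_web[of "max k k'"] F_subset_fast[of "max k k'"] by auto
  ultimately show "connected_component (fast_escaping_set f) z z'"
    using D(3) D'(3) unfolding connected_component_def by blast
qed

lemma spiders_webI:
  assumes "connected E" "fast_escaping_set f \<subseteq> E"
  shows "spiders_web E"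
  unfolding spiders_web_def
proof (intro conjI assms(1) exI[of _ web] allI)
  show "web n \<noteq> {}" for n using ball_subset_web[of n] level_pos[of n] by force
  show "frontier (web n) \<subseteq> E" for n using frontier_web F_subset_fast assms(2) by blast
  show "(\<Union>n. web n) = UNIV" using web_exhausts by auto
  show "web n \<subseteq> web (Suc n)" for n by (rule web_mono) simp
qed (simp_all add: open_web connected_web bounded_web simply_connected_web)

section \<open>Connectedness of the escaping set\<close>

lemma fast_escaping_invariant:
  assumes "(f ^^ n) z \<in> fast_escaping_set f"
  shows "z \<in> fast_escaping_set f"
proof -
  obtain l where "(f ^^ l) ((f ^^ n) z) \<in> fast_escaping_level f R"
    using assms unfolding fast_escaping_set_eq[OF fast_radius] by blast
  then have "(f ^^ (l + n)) z \<in> fast_escaping_level f R" by (simp add: funpow_add)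
  then show ?thesis unfolding fast_escaping_set_eq[OF fast_radius] by blast
qed

lemma fast_subset_escaping: "fast_escaping_set f \<subseteq> escaping_set f"
proof
  fix z assume "z \<in> fast_escaping_set f"
  then obtain l where l: "\<And>n. n \<ge> 1 \<Longrightarrow> level R n \<le> norm ((f ^^ n) ((f ^^ l) z))"
    unfolding fast_escaping_set_eq[OF fast_radius] by (auto simp: fast_escaping_level_def)
  show "z \<in> escaping_set f"
    unfolding escaping_set_def filterlim_at_infinity[OF order_refl] mem_Collect_eq eventually_sequentially
  proof (intro allI impI)
    fix B :: real
    obtain k where k: "level R k \<ge> B" using filterlim_at_top_obtains[OF level_tendsto] .
    have "B \<le> norm ((f ^^ n) z)" if "n \<ge> k + l + 1" for n
    proof -
      have "level R k \<le> level R (n - l)" by (rule level_incr) (use that in simp)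
      then have "B \<le> level R (n - l)" using k by linarith
      also have "\<dots> \<le> norm ((f ^^ (n - l)) ((f ^^ l) z))" using that by (intro l) simp
      also have "(f ^^ (n - l)) ((f ^^ l) z) = (f ^^ n) z"
        using funpow_add[of "n - l" l f] that by simp
      finally show ?thesis .
    qed
    then show "\<exists>N. \<forall>n\<ge>N. B \<le> norm ((f ^^ n) z)" by blast
  qed
qed

text \<open>A component of a separating open set that misses the fast escaping set can never be cut by the
  boundaries of the domains \<open>web k\<close>, so once one of its points escapes, its closure does as well.\<close>

lemma closure_escapes:
  assumes G: "connected G" "G \<inter> fast_escaping_set f = {}" and z: "z \<in> G" "z \<in> escaping_set f"
  shows "closure G \<subseteq> escaping_set f"
proof
  fix w assume w: "w \<in> closure G"
  show "w \<in> escaping_set f"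
    unfolding escaping_set_def filterlim_at_infinity[OF order_refl] mem_Collect_eq eventually_sequentially
  proof (intro allI impI)
    fix B :: real
    obtain k where k: "level R k \<ge> B" using filterlim_at_top_obtains[OF level_tendsto] .
    obtain n0 where n0: "\<And>n. n \<ge> n0 \<Longrightarrow> max 1 ((m ^^ k) r) \<le> norm ((f ^^ n) z)"
      using z(2) unfolding escaping_set_def filterlim_at_infinity[OF order_refl] mem_Collect_eq eventually_sequentially
      by (metis less_max_iff_disj zero_less_one)
    have "B \<le> norm ((f ^^ n) w)" if n: "n \<ge> n0" for n
    proof -
      have con: "connected ((f ^^ n) ` G)" by (intro connected_continuous_image cont_funpow G)
      have "(f ^^ n) ` G \<inter> frontier (web k) = {}"
        using fast_escaping_invariant frontier_web[of k] F_subset_fast[of k] G(2) by blast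
      moreover have "(f ^^ n) z \<notin> web k" using web_subset_ball[of k] n0[OF n] by auto
      \<comment> \<open>The orbit of \<open>z\<close> places the connected image outside
        \<open>web k\<close>; without meeting the frontier it cannot enter.\<close>
      ultimately have dis: "(f ^^ n) ` G \<inter> web k = {}"
        using connected_Int_frontier[OF con, of "web k"] z(1) by blast
      have "B \<le> norm ((f ^^ n) v)" if "v \<in> G" for v
      proof -
        have "(f ^^ n) v \<notin> ball 0 (level R k)" using dis that ball_subset_web[of k] by blast
        then show ?thesis using k by simp
      qed
      then have "G \<subseteq> {v. B \<le> norm ((f ^^ n) v)}" by blast
      moreover have "closed {v. B \<le> norm ((f ^^ n) v)}"
        by (intro closed_Collect_le continuous_intros cont_funpow)
      ultimately show ?thesis using w closure_minimal by blast
    qed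
    then show "\<exists>N. \<forall>n\<ge>N. B \<le> norm ((f ^^ n) w)" by blast
  qed
qed

lemma fast_escaping_nonempty: "fast_escaping_set f \<noteq> {}"
proof -
  have "web 0 \<noteq> {}" "web 0 \<noteq> UNIV"
    using ball_subset_web[of 0] R_pos bounded_web[of 0] not_bounded_UNIV by force+
  then have "frontier (web 0) \<noteq> {}" by (simp add: frontier_eq_empty)
  then show ?thesis using frontier_web[of 0] F_subset_fast[of 0] by blast
qed

text \<open>As \<open>A(f)\<close> is connected, one of two separating open sets contains it. A
  point in the other part of \<open>I(f)\<close> then lies in a domain \<open>G\<close> that misses
  \<open>A(f)\<close>; its closure escapes, although its frontier avoids \<open>I(f)\<close>, so
  \<open>G\<close> would be the whole plane.\<close>

lemma connected_escaping: "connected (escaping_set f)"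
proof (rule ccontr)
  assume "\<not> connected (escaping_set f)"
  then obtain A B where AB: "open A" "open B" "escaping_set f \<subseteq> A \<union> B" "A \<inter> B \<inter> escaping_set f = {}"
    "A \<inter> escaping_set f \<noteq> {}" "B \<inter> escaping_set f \<noteq> {}"
    unfolding connected_def by blast
  have contra: False
    if AB: "open A" "open B" "escaping_set f \<subseteq> A \<union> B" "A \<inter> B \<inter> escaping_set f = {}"
      "B \<inter> escaping_set f \<noteq> {}" and fA: "fast_escaping_set f \<subseteq> A" for A B
  proof -
    define P where "P = A \<inter> escaping_set f"
    define Q where "Q = B \<inter> escaping_set f"
    have fP: "fast_escaping_set f \<subseteq> P" using fA fast_subset_escaping by (auto simp: P_def)
    have ne: "P \<noteq> {}" "Q \<noteq> {}" using fP fast_escaping_nonempty AB by (auto simp: Q_def)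
    have sep: "infdist x P > 0" if "x \<in> Q" for x
    proof -
      have "x \<in> - closure P"
      proof -
        have "B \<inter> P = {}" using AB by (auto simp: P_def)
        then have "B \<inter> closure P = {}" using AB(2) by (simp add: open_Int_closure_eq_empty)
        then show ?thesis using that by (auto simp: Q_def)
      qed
      then show ?thesis using in_closure_iff_infdist_zero[OF ne(1), of x] infdist_nonneg[of x P] by fastforce
    qed
    have sep': "infdist x Q > 0" if "x \<in> P" for x
    proof -
      have "x \<in> - closure Q"
      proof -
        have "A \<inter> Q = {}" using AB by (auto simp: Q_def)
        then have "A \<inter> closure Q = {}" using AB(1) by (simp add: open_Int_closure_eq_empty)
        then show ?thesis using that by (auto simp: P_def)
      qed
      then show ?thesis using in_closure_iff_infdist_zero[OF ne(2), of x] infdist_nonneg[of x Q] by fastforce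
    qed
    \<comment> \<open>The frontier of \<open>W\<close> is equidistant from \<open>P\<close> and
      \<open>Q\<close>, while a point of either set has distance 0 from its own set and positive
      distance from the other.\<close>
    define W where "W = {x. infdist x Q < infdist x P}"
    have opW: "open W" unfolding W_def by (intro open_Collect_less continuous_intros)
    have "closed {x. infdist x Q \<le> infdist x P}" by (intro closed_Collect_le continuous_intros)
    then have "closure W \<subseteq> {x. infdist x Q \<le> infdist x P}" by (intro closure_minimal) (auto simp: W_def)
    then have frW: "infdist x Q = infdist x P" if "x \<in> frontier W" for x
      using that opW by (auto simp: frontier_def interior_open W_def)
    have frI: "frontier W \<inter> escaping_set f = {}"
    proof (rule ccontr)
      assume "\<not> ?thesis"
      then obtain x where x: "x \<in> frontier W" "x \<in> escaping_set f" by blast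
      then have "x \<in> P \<or> x \<in> Q" using AB by (auto simp: P_def Q_def)
      then show False
        using frW[OF x(1)] sep[of x] sep'[of x] by (auto simp: infdist_zero)
    qed
    obtain z where z: "z \<in> Q" using ne by blast
    have zW: "z \<in> W" using z sep[OF z] by (simp add: W_def infdist_zero)
    define G where "G = connected_component_set W z"
    have G: "connected G" "z \<in> G" "G \<subseteq> W" unfolding G_def using zW by (auto simp: connected_component_subset)
    have WP: "W \<inter> P = {}"
    proof -
      have "x \<notin> W" if "x \<in> P" for x
        using infdist_zero[OF that] infdist_nonneg[of x Q] by (simp add: W_def)
      then show ?thesis by blast
    qed
    have dis: "G \<inter> fast_escaping_set f = {}" using G(3) WP fP by blast
    have "closure G \<subseteq> escaping_set f"
      by (rule closure_escapes[OF G(1) dis G(2)]) (use z in \<open>simp add: Q_def\<close>)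
    moreover have "frontier G \<subseteq> frontier W" unfolding G_def by (rule frontier_of_connected_component_subset)
    ultimately have "frontier G = {}" using frI unfolding frontier_def by blast
    then have "G = UNIV" using G(2) by (auto simp: frontier_eq_empty)
    then show False using dis fast_escaping_nonempty by blast
  qed
  have "fast_escaping_set f \<subseteq> A \<or> fast_escaping_set f \<subseteq> B"
  proof (rule ccontr)
    assume no: "\<not> ?thesis"
    have "fast_escaping_set f \<subseteq> A \<union> B" "A \<inter> B \<inter> fast_escaping_set f = {}"
      using AB(3,4) fast_subset_escaping by blast+
    then show False using connectedD[OF connected_fast_escaping AB(1,2)] no by blast
  qed
  then show False
  proof
    assume "fast_escaping_set f \<subseteq> A"
    then show False using contra[of A B] AB by blast
  next
    assume "fast_escaping_set f \<subseteq> B"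
    then show False using contra[of B A] AB by blast
  qed
qed

text \<open>An unbounded component containing \<open>z\<close> would contain some \<open>z'\<close>
  whose orbit is one application of \<open>M\<close> ahead of the upper bound for the orbit of
  \<open>z\<close>. Comparability of the logarithms would give \<open>M(s) \<le> s^K\<close> for
  arbitrarily large \<open>s\<close>, against \<open>log_max_superlinear\<close>.\<close>

lemma bounded_Fatou_component:
  assumes C: "C \<in> components (Fatou_set f)"
  shows "bounded C"
proof (rule ccontr)
  assume unb: "\<not> bounded C"
  obtain z where z: "z \<in> C" using in_components_nonempty[OF C] by blast
  obtain i where i: "level R i \<ge> norm z" using filterlim_at_top_obtains[OF level_tendsto] .
  obtain i' where "z \<in> web i'" using web_exhausts by blast
  define k where "k = max (Suc i) i'"
  have "z \<in> web k" using \<open>z \<in> web i'\<close> web_mono[of i' k] by (auto simp: k_def)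
  then have "C \<inter> frontier (web k) \<noteq> {}"
    using unbounded_meets_frontier_web[OF in_components_connected[OF C] unb, of k] z by blast
  then obtain z' where z': "z' \<in> C" "z' \<in> F k" using frontier_web by blast
  have esc': "z' \<in> escaping_set f" using z'(2) F_subset_fast fast_subset_escaping by blast
  from escaping_rate_on_Fatou_component[OF C z'(1) esc' z]
  obtain K n0 where zI: "z \<in> escaping_set f" and K: "K > 0"
    "\<And>n. n \<ge> n0 \<Longrightarrow> ln (norm ((f ^^ n) z')) \<le> K * ln (norm ((f ^^ n) z))" by blast
  obtain n1 where n1: "\<And>n. n \<ge> n1 \<Longrightarrow> 1 \<le> norm ((f ^^ n) z)"
    using zI unfolding escaping_set_def filterlim_at_infinity[OF order_refl] mem_Collect_eq eventually_sequentially
    by (metis zero_less_one)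
  obtain t0 where t0: "\<And>t. t \<ge> t0 \<Longrightarrow> (K + 1) * t \<le> log_max t" using log_max_superlinear by blast
  define c where "c = exp (max t0 1)"
  obtain n2 where n2: "level R n2 \<ge> c" using filterlim_at_top_obtains[OF level_tendsto] .
  define n where "n = n0 + n1 + n2 + 1"
  define t where "t = ln (level R (n + i))"
  have "c \<le> level R (n + i)" using n2 level_incr[of n2 "n + i"] by (simp add: n_def)
  then have t: "max t0 1 \<le> t" unfolding t_def c_def using level_pos[of "n + i"] by (subst ln_ge_iff) auto
  have et: "exp t = level R (n + i)" unfolding t_def using level_pos by simp
  have "log_max t \<le> ln (norm ((f ^^ n) z'))"
  proof -
    have "level R (Suc (n + i)) \<le> level R (n + k)" by (rule level_incr) (simp add: k_def)
    also have "\<dots> \<le> norm ((f ^^ n) z')"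
    proof -
      have "1 \<le> n" by (simp add: n_def)
      then show ?thesis using z'(2) unfolding mem_F by blast
    qed
    finally show ?thesis unfolding log_max_def et
      using level_pos[of "Suc (n + i)"] by (intro ln_mono) auto
  qed
  also have "\<dots> \<le> K * ln (norm ((f ^^ n) z))" by (rule K(2)) (simp add: n_def)
  also have "\<dots> \<le> K * t"
  proof -
    have "norm ((f ^^ n) z) \<le> level (level R i) n" by (rule norm_funpow_le_max_modulus[OF i])
    also have "\<dots> = level R (n + i)" by (simp add: funpow_add)
    finally have "ln (norm ((f ^^ n) z)) \<le> t" unfolding t_def
      using n1[of n] level_pos[of "n + i"] by (intro ln_mono) (auto simp: n_def)
    then show ?thesis using K(1) by simp
  qed
  finally show False using t0[of t] t by (simp add: algebra_simps)
qed

end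

theorem theorem1p3:
  fixes f :: "complex \<Rightarrow> complex"
  assumes "transcendental_entire f"
    and "\<exists>\<rho>>0. filterlim (\<lambda>n. (min_modulus f ^^ n) \<rho>) at_top sequentially"
  shows "(V_set f = fast_escaping_set f \<longleftrightarrow>
            (\<exists>r R. r \<ge> R \<and> R > 0 \<and>
               (\<forall>n\<ge>1. (min_modulus f ^^ n) r \<ge> (max_modulus f ^^ n) R) \<and>
               filterlim (\<lambda>n. (max_modulus f ^^ n) R) at_top sequentially)) \<and>
         (V_set f = fast_escaping_set f \<longrightarrow>
            (spiders_web (V_set f) \<and> spiders_web (escaping_set f)) \<and>
            (\<forall>C\<in>components (Fatou_set f). bounded C))"
    (is "(?eq \<longleftrightarrow> ?iter) \<and> (?eq \<longrightarrow> ?webs)")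
proof -
  interpret transcendental_map f by unfold_locales (rule assms(1))
  obtain \<rho> where \<rho>: "\<rho> > 0" "filterlim (\<lambda>n. (min_modulus f ^^ n) \<rho>) at_top sequentially"
    using assms(2) by blast
  have V: "V_radius f \<rho>" using \<rho> by (rule V_radius_exists)
  have eq_iter: "?eq \<longrightarrow> ?iter" using iterated_moduli_of_V_eq_fast[OF V] by blast
  moreover have "?iter \<longrightarrow> ?eq"
  proof
    assume ?iter
    then obtain r R where "R \<le> r" "R > 0" "\<And>n. n \<ge> 1 \<Longrightarrow> (M ^^ n) R \<le> (m ^^ n) r"
      "filterlim (\<lambda>n. (M ^^ n) R) at_top sequentially" by blast
    then show ?eq
      by (intro equalityI V_subset_fast_escaping[OF V] fast_escaping_subset_V[OF V])
  qed
  moreover have "?eq \<longrightarrow> ?webs"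
  proof
    assume eq: ?eq
    then obtain r R where rR: "R \<le> r" "R > 0" "\<And>n. n \<ge> 1 \<Longrightarrow> (M ^^ n) R \<le> (m ^^ n) r"
      "filterlim (\<lambda>n. (M ^^ n) R) at_top sequentially" using eq_iter by blast
    interpret fast_min_modulus f r R by unfold_locales (use rR in auto)
    have "spiders_web (fast_escaping_set f)" by (rule spiders_webI[OF connected_fast_escaping order_refl])
    then show ?webs
      using spiders_webI[OF connected_escaping fast_subset_escaping] bounded_Fatou_component eq by simp
  qed
  ultimately show ?thesis by blast
qed

end
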